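(* Let $Y$ be a random walk (as described in the context) and define $$\bar x:=\inf\Big\{y\in\mathbb R : \mathbb E\big(\gamma(y)-\gamma(y+S_{\tau_+})\big)\ge -\mathbb E\Big(\sum_{i=1}^{\tau_+}h(y+S_i)\Big)\Big\},$$ where $\bar x\in\mathbb R$. Assume that (i) $\mathbb E_y\big(\sup_n\{\gamma(Y_n)-\sum_{i=1}^n h(Y_i)\}\big)<\infty$ for all $y\in\mathbb R$ and $\gamma(Y_n)-\sum_{i=1}^n h(Y_i)\to-\infty$ almost surely as $n\to\infty$; (ii) $\gamma$ is concave on $[\bar x,\infty)$; (iii) $h$ is non-decreasing and non-negative. Then: - if $f(\bar x)\le 0$, then $\tau^*=\inf\{n\ge 0: Y_n\ge\bar x\}$ is an optimal stopping time; - if $f(\bar x)>0$, then $\tau^*=\inf\{n\ge 0: Y_n>\bar x\}$ is an optimal stopping time. Here "optimal" means that $\tau^*$ attains the supremum defining $V(y)$ for every $y\in\mathbb R$.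
   Context: Random walk: $(X_i)_{i\in\mathbb N}$ is a sequence of independent, identically distributed real random variables with $\mathbb P(X_1>0)>0$, $S_n:=\sum_{i=1}^n X_i$ for $n\in\mathbb N_0$, and under $\mathbb P_y$ the process $Y$ has the law of $Y_n^y:=y+S_n$, $n\ge 0$. Write $\mathbb P:=\mathbb P_0$, $\mathbb E:=\mathbb E_0$. $\gamma:\mathbb R\to\mathbb R$ is a non-decreasing function. The value function of the stopping problem is $$V(y):=\sup_{\tau\in\mathcal T}\mathbb E_y\Big(\gamma(Y_\tau)-\sum_{i=1}^{\tau}h(Y_i)\Big),$$ with $\mathcal T$ the set of all stopping times; on $\{\tau=\infty\}$ the pay-off is understood as the almost sure limit $-\infty$ from (i). $\tau_+=\tau^+:=\inf\{n\ge 0: S_n>0\}$ is the first strict ascending ladder time, and $$\phi(y):=\mathbb E\Big(\gamma(y+S_{\tau^+})-\sum_{i=1}^{\tau^+}h(y+S_i)\Big),\qquad f(y):=\frac{\phi(y)-\gamma(y)}{\mathbb E(\tau^+)}.$$ Standing assumption: $f$ is a well-defined real-valued function on $\mathbb R$ (degenerate cases in which one or more of the terms occurring in it are infinite are excluded). *)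

theory Defs
  imports "HOL-Probability.Probability"
begin

text \<open>The steps of the walk are \<open>X 1, X 2, \<dots>\<close>; the value \<open>X 0\<close> is never used.\<close>

definition iid_steps :: "'a measure \<Rightarrow> (nat \<Rightarrow> 'a \<Rightarrow> real) \<Rightarrow> bool" where
  "iid_steps M X \<longleftrightarrow>
     prob_space.indep_vars M (\<lambda>_. borel) X {1..} \<and>
     (\<forall>i\<ge>1. distr M borel (X i) = distr M borel (X 1))"

definition walk :: "(nat \<Rightarrow> 'a \<Rightarrow> real) \<Rightarrow> nat \<Rightarrow> 'a \<Rightarrow> real" where
  "walk X n \<omega> = (\<Sum>i=1..n. X i \<omega>)"

text \<open>
  Instead of a family of laws of \<open>Y\<close> indexed by the starting point \<open>y\<close>, we keep one
  probability space and use \<open>y + walk X n\<close>.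

  The natural filtration. Its index type is \<^typ>\<open>enat\<close> so that the library's
  \<^const>\<open>stopping_time\<close> covers times that may be infinite; at \<open>\<infinity>\<close> the
  stopping condition is vacuous. A deterministic starting point does not change it.
\<close>

definition walk_filtration ::
    "'a measure \<Rightarrow> (nat \<Rightarrow> 'a \<Rightarrow> real) \<Rightarrow> enat \<Rightarrow> 'a measure" where
  "walk_filtration M X t =
     sigma (space M)
       {walk X i -` B \<inter> space M | i B. enat i \<le> t \<and> B \<in> sets (borel :: real measure)}"

text \<open>The infimum of the empty set is \<open>\<infinity>\<close>.\<close>

definition first_time :: "(nat \<Rightarrow> bool) \<Rightarrow> enat" where
  "first_time P = Inf (enat ` {n. P n})"

definition ladder_time :: "(nat \<Rightarrow> 'a \<Rightarrow> real) \<Rightarrow> 'a \<Rightarrow> enat" where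
  "ladder_time X \<omega> = first_time (\<lambda>n. walk X n \<omega> > 0)"

definition running_cost ::
    "(real \<Rightarrow> real) \<Rightarrow> (nat \<Rightarrow> 'a \<Rightarrow> real) \<Rightarrow> real \<Rightarrow> nat \<Rightarrow> 'a \<Rightarrow> real" where
  "running_cost h X y n \<omega> = (\<Sum>i=1..n. h (y + walk X i \<omega>))"

definition payoff ::
    "(real \<Rightarrow> real) \<Rightarrow> (real \<Rightarrow> real) \<Rightarrow> (nat \<Rightarrow> 'a \<Rightarrow> real) \<Rightarrow> real \<Rightarrow> nat \<Rightarrow> 'a \<Rightarrow> real" where
  "payoff \<gamma> h X y n \<omega> = \<gamma> (y + walk X n \<omega>) - running_cost h X y n \<omega>"

definition stopped_payoff ::
    "(real \<Rightarrow> real) \<Rightarrow> (real \<Rightarrow> real) \<Rightarrow> (nat \<Rightarrow> 'a \<Rightarrow> real) \<Rightarrow> real \<Rightarrow> ('a \<Rightarrow> enat) \<Rightarrow> 'a \<Rightarrow> ereal" where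
  "stopped_payoff \<gamma> h X y \<tau> \<omega> =
     (case \<tau> \<omega> of enat n \<Rightarrow> ereal (payoff \<gamma> h X y n \<omega>) | \<infinity> \<Rightarrow> - \<infinity>)"

text \<open>
  Extended-real expectation, positive part minus negative part. It is meaningful if at most
  one of the two parts is infinite (\<open>\<infinity> - \<infinity> = \<infinity>\<close> in \<^typ>\<open>ereal\<close>). Below it is applied to
  the supremum of the pay-offs, which is bounded below by the constant \<open>\<gamma> y\<close>, and to stopped
  pay-offs, which are bounded above by that supremum.
\<close>

definition ereal_expectation :: "'a measure \<Rightarrow> ('a \<Rightarrow> ereal) \<Rightarrow> ereal" where
  "ereal_expectation M Z =
     enn2ereal (\<integral>\<^sup>+ \<omega>. e2ennreal (Z \<omega>) \<partial>M) - enn2ereal (\<integral>\<^sup>+ \<omega>. e2ennreal (- Z \<omega>) \<partial>M)"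

definition stopping_value ::
    "'a measure \<Rightarrow> (nat \<Rightarrow> 'a \<Rightarrow> real) \<Rightarrow> (real \<Rightarrow> real) \<Rightarrow> (real \<Rightarrow> real) \<Rightarrow> real \<Rightarrow> ereal" where
  "stopping_value M X \<gamma> h y =
     (SUP \<tau> \<in> {\<tau>. stopping_time (walk_filtration M X) \<tau>}.
        ereal_expectation M (stopped_payoff \<gamma> h X y \<tau>))"

text \<open>The rule \<open>\<tau>\<close> gives, for each starting point \<open>y\<close>, the time \<open>\<tau> y\<close>.\<close>

definition optimal_rule ::
    "'a measure \<Rightarrow> (nat \<Rightarrow> 'a \<Rightarrow> real) \<Rightarrow> (real \<Rightarrow> real) \<Rightarrow> (real \<Rightarrow> real) \<Rightarrow>
     (real \<Rightarrow> 'a \<Rightarrow> enat) \<Rightarrow> bool" where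
  "optimal_rule M X \<gamma> h \<tau> \<longleftrightarrow>
     (\<forall>y. stopping_time (walk_filtration M X) (\<tau> y) \<and>
          ereal_expectation M (stopped_payoff \<gamma> h X y (\<tau> y)) = stopping_value M X \<gamma> h y)"

text \<open>
  Quantities at the first strict ascending ladder time. On the event that the ladder time is
  infinite \<^const>\<open>the_enat\<close> is unspecified; this event is null as soon as the ladder time
  has finite mean.
\<close>

definition mean_ladder_time :: "'a measure \<Rightarrow> (nat \<Rightarrow> 'a \<Rightarrow> real) \<Rightarrow> ennreal" where
  "mean_ladder_time M X = (\<integral>\<^sup>+ \<omega>. ennreal_of_enat (ladder_time X \<omega>) \<partial>M)"

definition ladder_reward ::
    "(real \<Rightarrow> real) \<Rightarrow> (nat \<Rightarrow> 'a \<Rightarrow> real) \<Rightarrow> real \<Rightarrow> 'a \<Rightarrow> real" where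
  "ladder_reward \<gamma> X y \<omega> = \<gamma> (y + walk X (the_enat (ladder_time X \<omega>)) \<omega>)"

definition ladder_cost ::
    "(real \<Rightarrow> real) \<Rightarrow> (nat \<Rightarrow> 'a \<Rightarrow> real) \<Rightarrow> real \<Rightarrow> 'a \<Rightarrow> real" where
  "ladder_cost h X y \<omega> = running_cost h X y (the_enat (ladder_time X \<omega>)) \<omega>"

definition ladder_phi ::
    "'a measure \<Rightarrow> (nat \<Rightarrow> 'a \<Rightarrow> real) \<Rightarrow> (real \<Rightarrow> real) \<Rightarrow> (real \<Rightarrow> real) \<Rightarrow> real \<Rightarrow> real" where
  "ladder_phi M X \<gamma> h y = (\<integral>\<omega>. ladder_reward \<gamma> X y \<omega> - ladder_cost h X y \<omega> \<partial>M)"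

definition ladder_f ::
    "'a measure \<Rightarrow> (nat \<Rightarrow> 'a \<Rightarrow> real) \<Rightarrow> (real \<Rightarrow> real) \<Rightarrow> (real \<Rightarrow> real) \<Rightarrow> real \<Rightarrow> real" where
  "ladder_f M X \<gamma> h y = (ladder_phi M X \<gamma> h y - \<gamma> y) / enn2real (mean_ladder_time M X)"

text \<open>The function \<^const>\<open>ladder_f\<close> is well defined: no term occurring in it is infinite.\<close>

definition ladder_f_well_defined ::
    "'a measure \<Rightarrow> (nat \<Rightarrow> 'a \<Rightarrow> real) \<Rightarrow> (real \<Rightarrow> real) \<Rightarrow> (real \<Rightarrow> real) \<Rightarrow> bool" where
  "ladder_f_well_defined M X \<gamma> h \<longleftrightarrow>
     mean_ladder_time M X < \<infinity> \<and>
     (\<forall>y. integrable M (ladder_reward \<gamma> X y) \<and> integrable M (ladder_cost h X y))"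

definition threshold_set ::
    "'a measure \<Rightarrow> (nat \<Rightarrow> 'a \<Rightarrow> real) \<Rightarrow> (real \<Rightarrow> real) \<Rightarrow> (real \<Rightarrow> real) \<Rightarrow> real set" where
  "threshold_set M X \<gamma> h =
     {y. (\<integral>\<omega>. \<gamma> y - ladder_reward \<gamma> X y \<omega> \<partial>M) \<ge> - (\<integral>\<omega>. ladder_cost h X y \<omega> \<partial>M)}"

end

theory Submission
  imports Defs
begin

text \<open>
  By definition of \<open>xbar\<close>, \<open>f\<close> is positive below the stopping set \<open>B\<close> (a ray starting at \<open>xbar\<close>); since
  \<open>\<gamma>\<close> is concave and \<open>h\<close> non-decreasing, it is non-positive and non-increasing on \<open>B\<close>. Summing over
  ladder times, waiting
  for the entry into \<open>B\<close> is favourable below \<open>B\<close>. From \<open>y \<in> B\<close>, the first return to \<open>B\<close> is no later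
  than the ladder time, and for the reward rate shifted by \<open>- f y\<close> waiting for the ladder time is neutral
  at \<open>y\<close> and favourable at the points of \<open>B\<close> below \<open>y\<close>; so waiting for the return does not pay.
  Hence a stopping time can be postponed to \<open>B\<close> and then moved step by step to the first entry into
  \<open>B\<close>. This needs integrable bounds, so the stopping time is first truncated at the passage of a high
  level; the error is controlled since the expected gain of continuing from a point above \<open>xbar\<close> is
  bounded uniformly, again by concavity.
\<close>

subsection \<open>Path space\<close>

text \<open>The ladder time takes the place of the single step: before it the walk stays at or below
  its starting point. So from a point below \<open>B\<close> no entry into \<open>B\<close> is
  missed by passing to ladder times, and from a point of \<open>B\<close> the walk has returned to
  \<open>B\<close> at the latest at the ladder time. The endpoint \<open>xbar\<close> belongs to
  \<open>B\<close> exactly when \<open>f xbar\<close> is non-positive, since otherwise waiting still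
  pays at \<open>xbar\<close>; an abstract ray \<open>B\<close> covers both cases. Restarting at
  random times is done on the product space of the steps, where the strong Markov property is an
  identity of measures: replacing the steps after a stopping time by an independent path preserves
  the law.\<close>

lemma first_time_eq_enat: "first_time P = enat n \<longleftrightarrow> P n \<and> (\<forall>m<n. \<not> P m)"
proof
  assume *: "first_time P = enat n"
  then have "{n. P n} \<noteq> {}"
    by (auto simp: first_time_def Inf_enat_def split: if_splits)
  then have "first_time P \<in> enat ` {n. P n}"
    unfolding first_time_def by (metis (no_types, lifting) Inf_enat_def LeastI_ex all_not_in_conv image_is_empty)
  moreover have "first_time P \<le> enat m" if "P m" for m
    unfolding first_time_def by (rule Inf_lower) (use that in auto)
  ultimately show "P n \<and> (\<forall>m<n. \<not> P m)"
    using * by force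
next
  assume *: "P n \<and> (\<forall>m<n. \<not> P m)"
  show "first_time P = enat n"
    unfolding first_time_def
  proof (rule antisym)
    show "Inf (enat ` {n. P n}) \<le> enat n"
      by (rule Inf_lower) (use * in auto)
    show "enat n \<le> Inf (enat ` {n. P n})"
      by (rule Inf_greatest) (use * in \<open>auto simp: not_less[symmetric]\<close>)
  qed
qed

lemma first_time_eq_infinity: "first_time P = \<infinity> \<longleftrightarrow> (\<forall>n. \<not> P n)"
proof -
  have "first_time P \<le> enat m" if "P m" for m
    unfolding first_time_def by (rule Inf_lower) (use that in auto)
  moreover have "first_time P = \<infinity>" if "\<forall>n. \<not> P n"
    using that by (simp add: first_time_def Inf_enat_def)
  ultimately show ?thesis
    by (metis enat_ord_simps(5) infinity_ileE)
qed

lemma first_time_le_iff: "first_time P \<le> enat n \<longleftrightarrow> (\<exists>m\<le>n. P m)"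
proof
  assume "first_time P \<le> enat n"
  then obtain m where "first_time P = enat m" "m \<le> n"
    by (metis enat_ile enat_ord_simps(1))
  then show "\<exists>m\<le>n. P m"
    using first_time_eq_enat by metis
next
  assume "\<exists>m\<le>n. P m"
  then obtain m where "m \<le> n" "P m" by blast
  then have "first_time P \<le> enat m"
    unfolding first_time_def by (intro Inf_lower) auto
  then show "first_time P \<le> enat n"
    using \<open>m \<le> n\<close> by (meson enat_ord_simps(1) order_trans)
qed

lemma first_time_cong_upto:
  assumes "first_time P = enat n" "\<And>m. m \<le> n \<Longrightarrow> P m \<longleftrightarrow> Q m"
  shows "first_time Q = enat n"
  using assms by (simp add: first_time_eq_enat)

lemma measurable_first_time:
  assumes [measurable]: "\<And>n. Measurable.pred M (\<lambda>x. P n x)"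
  shows "(\<lambda>x. first_time (\<lambda>n. P n x)) \<in> measurable M (count_space UNIV)"
proof -
  have eq: "first_time Q = (if \<exists>n. Q n then enat (LEAST n. Q n) else \<infinity>)" for Q
    by (auto simp: first_time_eq_enat first_time_eq_infinity intro: LeastI dest: not_less_Least)
  show ?thesis
    unfolding eq by measurable
qed

text \<open>
  A path is the sequence of its steps. Coordinate \<open>i\<close> of a path is step \<open>i + 1\<close> of the walk,
  because the steps of the walk are numbered from \<open>1\<close>.
\<close>

definition psum :: "(nat \<Rightarrow> real) \<Rightarrow> nat \<Rightarrow> real" where
  "psum x n = (\<Sum>i<n. x i)"

text \<open>The positions at times \<open>1\<close> to \<open>n\<close> are charged: the starting
  point is free, the position at time \<open>n\<close> is not.\<close>

definition cost :: "(real \<Rightarrow> real) \<Rightarrow> real \<Rightarrow> (nat \<Rightarrow> real) \<Rightarrow> nat \<Rightarrow> real" where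
  "cost h z x n = (\<Sum>i<n. h (z + psum x (Suc i)))"

definition pay :: "(real \<Rightarrow> real) \<Rightarrow> (real \<Rightarrow> real) \<Rightarrow> real \<Rightarrow> (nat \<Rightarrow> real) \<Rightarrow> nat \<Rightarrow> real" where
  "pay \<gamma> h z x n = \<gamma> (z + psum x n) - cost h z x n"

text \<open>The lower bound \<open>r\<close> serves three purposes: \<open>0\<close> gives the first
  entry, \<open>1\<close> the first return, and a stopping time in place of \<open>r\<close> gives
  its postponement to the next visit of \<open>U\<close>.\<close>

definition entry_from :: "enat \<Rightarrow> real set \<Rightarrow> real \<Rightarrow> (nat \<Rightarrow> real) \<Rightarrow> enat" where
  "entry_from r U z x = first_time (\<lambda>n. r \<le> enat n \<and> z + psum x n \<in> U)"

abbreviation entry :: "real set \<Rightarrow> real \<Rightarrow> (nat \<Rightarrow> real) \<Rightarrow> enat" where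
  "entry \<equiv> entry_from 0"

text \<open>Extension of \<open>comb_seq\<close> to splicing times that may be infinite, in which
  case the second path is discarded.\<close>

definition comb_at :: "enat \<Rightarrow> (nat \<Rightarrow> real) \<Rightarrow> (nat \<Rightarrow> real) \<Rightarrow> nat \<Rightarrow> real" where
  "comb_at t x x' = (case t of enat n \<Rightarrow> comb_seq n x x' | \<infinity> \<Rightarrow> x)"

section \<open>Sums, costs and entry times of spliced paths\<close>

lemma comb_at_enat [simp]: "comb_at (enat n) = comb_seq n"
  by (simp add: comb_at_def fun_eq_iff)

lemma psum_0 [simp]: "psum x 0 = 0"
  by (simp add: psum_def)

lemma cost_0 [simp]: "cost h z x 0 = 0"
  by (simp add: cost_def)

lemma pay_0 [simp]: "pay \<gamma> h z x 0 = \<gamma> z"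
  by (simp add: pay_def)

lemma psum_comb_le: "n \<le> s \<Longrightarrow> psum (comb_seq s x x') n = psum x n"
  by (simp add: psum_def comb_seq_def)

lemma psum_comb_add: "psum (comb_seq s x x') (s + m) = psum x s + psum x' m"
proof (induction m)
  case 0
  then show ?case by (simp add: psum_comb_le)
next
  case (Suc m)
  have "psum (comb_seq s x x') (s + Suc m) = psum (comb_seq s x x') (s + m) + comb_seq s x x' (s + m)"
    by (simp add: psum_def)
  then show ?case
    using Suc by (simp add: comb_seq_def psum_def)
qed

lemma cost_comb_le: "n \<le> s \<Longrightarrow> cost h z (comb_seq s x x') n = cost h z x n"
  by (simp add: cost_def psum_comb_le)

lemma cost_comb_add:
  "cost h z (comb_seq s x x') (s + m) = cost h z x s + cost h (z + psum x s) x' m"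
proof (induction m)
  case 0
  then show ?case by (simp add: cost_comb_le)
next
  case (Suc m)
  have "cost h z (comb_seq s x x') (s + Suc m) = cost h z (comb_seq s x x') (s + m)
      + h (z + psum (comb_seq s x x') (s + Suc m))"
    by (simp add: cost_def)
  then show ?case
    using Suc unfolding psum_comb_add by (simp add: cost_def add.assoc)
qed

lemma pay_comb_le: "n \<le> s \<Longrightarrow> pay \<gamma> h z (comb_seq s x x') n = pay \<gamma> h z x n"
  by (simp add: pay_def cost_comb_le psum_comb_le)

lemma pay_comb_add:
  "pay \<gamma> h z (comb_seq s x x') (s + m) = pay \<gamma> h (z + psum x s) x' m - cost h z x s"
  by (simp add: pay_def cost_comb_add psum_comb_add add.assoc)

lemma psum_cong: "(\<And>i. i < n \<Longrightarrow> x i = y i) \<Longrightarrow> psum x n = psum y n"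
  by (simp add: psum_def)

lemma cost_mono_time:
  assumes "\<And>u. h u \<ge> 0" "m \<le> n"
  shows "cost h z x m \<le> cost h z x n"
  unfolding cost_def by (rule sum_mono2) (use assms in auto)

lemma cost_nonneg: "(\<And>u. h u \<ge> 0) \<Longrightarrow> cost h z x n \<ge> 0"
  by (simp add: cost_def sum_nonneg)

lemma cost_mono_start:
  assumes "mono h" "z \<le> z'"
  shows "cost h z x n \<le> cost h z' x n"
  unfolding cost_def by (rule sum_mono) (use assms in \<open>auto intro: monoD\<close>)

lemma entry_from_eq_enat:
  "entry_from r U z x = enat n \<longleftrightarrow>
     r \<le> enat n \<and> z + psum x n \<in> U \<and> (\<forall>m<n. r \<le> enat m \<longrightarrow> z + psum x m \<notin> U)"
  by (auto simp: entry_from_def first_time_eq_enat)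

lemma entry_eq_enat:
  "entry U z x = enat n \<longleftrightarrow> z + psum x n \<in> U \<and> (\<forall>m<n. z + psum x m \<notin> U)"
  by (simp add: entry_from_eq_enat)

lemma entry_from_le_iff:
  "entry_from r U z x \<le> enat n \<longleftrightarrow> (\<exists>m\<le>n. r \<le> enat m \<and> z + psum x m \<in> U)"
  by (simp add: entry_from_def first_time_le_iff)

text \<open>The subtraction \<open>r - s\<close> is truncated, so one statement covers a bound
  already passed at the splice and one still ahead. For \<open>r = s\<close> and
  \<open>r = Suc s\<close> the assumption is vacuous; these cases give the postponement and the
  return.\<close>

lemma entry_from_comb:
  assumes "\<And>i. i < s \<Longrightarrow> r \<le> i \<Longrightarrow> z + psum x i \<notin> U"
  shows "entry_from (enat r) U z (comb_seq s x x')
    = enat s + entry_from (enat (r - s)) U (z + psum x s) x'"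
proof (cases "entry_from (enat (r - s)) U (z + psum x s) x'")
  case (enat m)
  have "entry_from (enat r) U z (comb_seq s x x') = enat (s + m)"
    unfolding entry_from_eq_enat
  proof (intro conjI allI impI)
    show "enat r \<le> enat (s + m)" "z + psum (comb_seq s x x') (s + m) \<in> U"
      using enat by (auto simp: entry_from_eq_enat psum_comb_add add.assoc)
    fix i assume i: "i < s + m" "enat r \<le> enat i"
    show "z + psum (comb_seq s x x') i \<notin> U"
    proof (cases "i < s")
      case True
      then show ?thesis using assms[of i] i by (simp add: psum_comb_le)
    next
      case False
      then obtain j where j: "i = s + j" using le_iff_add not_less by metis
      then show ?thesis
        using enat i by (auto simp: entry_from_eq_enat psum_comb_add add.assoc)
    qed
  qed
  then show ?thesis using enat by simp
next
  case infinity
  have "\<not> (enat r \<le> enat i \<and> z + psum (comb_seq s x x') i \<in> U)" for i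
  proof (cases "i < s")
    case True
    then show ?thesis using assms[of i] by (auto simp: psum_comb_le)
  next
    case False
    then obtain j where j: "i = s + j" using le_iff_add not_less by metis
    then show ?thesis
      using infinity by (auto simp: entry_from_def first_time_eq_infinity psum_comb_add add.assoc)
  qed
  then have "entry_from (enat r) U z (comb_seq s x x') = \<infinity>"
    unfolding entry_from_def first_time_eq_infinity by blast
  then show ?thesis
    using infinity by simp
qed

lemma entry_comb:
  assumes "\<And>i. i < s \<Longrightarrow> z + psum x i \<notin> U"
  shows "entry U z (comb_seq s x x') = enat s + entry U (z + psum x s) x'"
  using entry_from_comb[of s 0 z x U x'] assms by (simp add: zero_enat_def)

section \<open>The first strict ascending ladder time\<close>

definition ladder :: "(nat \<Rightarrow> real) \<Rightarrow> enat" where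
  "ladder x = entry {0<..} 0 x"

lemma entry_greaterThan_self: "entry {z<..} z x = ladder x"
  by (simp add: ladder_def entry_from_def)

lemma ladder_eq_enat: "ladder x = enat n \<longleftrightarrow> psum x n > 0 \<and> (\<forall>m<n. psum x m \<le> 0)"
  by (auto simp: ladder_def entry_eq_enat not_less)

lemma ladder_ge_1: "ladder x \<ge> 1"
proof (cases "ladder x")
  case (enat n)
  then have "psum x n > 0" by (auto simp: ladder_eq_enat)
  then have "n \<noteq> 0" by (cases n) auto
  then show ?thesis using enat by (simp add: one_enat_def)
qed simp

abbreviation ladder_height :: "(nat \<Rightarrow> real) \<Rightarrow> real" where
  "ladder_height x \<equiv> psum x (the_enat (ladder x))"

section \<open>Product space of the steps: measurability and stopping times\<close>

locale step_space = sequence_space \<mu> for \<mu> :: "real measure" +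
  assumes sets_mu [measurable_cong, simp]: "sets \<mu> = sets borel"
begin

lemma space_mu [simp]: "space \<mu> = UNIV"
  using sets_eq_imp_space_eq[OF sets_mu] by simp

lemma space_S [simp]: "space S = UNIV"
  by (simp add: space_PiM)

lemma sets_S_borel: "sets S = sets (\<Pi>\<^sub>M i\<in>UNIV::nat set. (borel :: real measure))"
  by (rule sets_PiM_cong) simp_all

lemma measurable_coord:
  assumes [measurable]: "f \<in> measurable K S"
  shows "(\<lambda>\<omega>. f \<omega> i) \<in> borel_measurable K"
proof -
  have "(\<lambda>x. x i) \<in> measurable S \<mu>"
    by measurable
  then have "(\<lambda>x. x i) \<in> borel_measurable S"
    by (simp add: measurable_cong_sets[OF refl sets_mu])
  from measurable_compose[OF assms this] show ?thesis .
qed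

lemma measurable_psum [measurable (raw)]:
  assumes [measurable]: "f \<in> measurable K S"
  shows "(\<lambda>\<omega>. psum (f \<omega>) n) \<in> borel_measurable K"
  unfolding psum_def by (intro borel_measurable_sum measurable_coord) measurable

lemma measurable_psum' [measurable (raw)]:
  assumes [measurable]: "f \<in> measurable K S" "t \<in> measurable K (count_space UNIV)"
  shows "(\<lambda>\<omega>. psum (f \<omega>) (t \<omega>)) \<in> borel_measurable K"
  by (rule measurable_compose_countable[of "\<lambda>n \<omega>. psum (f \<omega>) n"]) measurable

lemma measurable_cost [measurable (raw)]:
  assumes [measurable]: "h \<in> borel_measurable borel" "f \<in> measurable K S" "g \<in> borel_measurable K"
    "t \<in> measurable K (count_space UNIV)"
  shows "(\<lambda>\<omega>. cost h (g \<omega>) (f \<omega>) (t \<omega>)) \<in> borel_measurable K"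
proof (rule measurable_compose_countable[of "\<lambda>n \<omega>. cost h (g \<omega>) (f \<omega>) n"])
  show "(\<lambda>\<omega>. cost h (g \<omega>) (f \<omega>) n) \<in> borel_measurable K" for n
    unfolding cost_def by measurable
qed measurable

lemma measurable_pay [measurable (raw)]:
  assumes [measurable]: "\<gamma> \<in> borel_measurable borel" "h \<in> borel_measurable borel"
    "f \<in> measurable K S" "g \<in> borel_measurable K" "t \<in> measurable K (count_space UNIV)"
  shows "(\<lambda>\<omega>. pay \<gamma> h (g \<omega>) (f \<omega>) (t \<omega>)) \<in> borel_measurable K"
  unfolding pay_def by measurable

lemma measurable_entry_from [measurable (raw)]:
  assumes [measurable]: "U \<in> sets borel" "f \<in> measurable K S" "g \<in> borel_measurable K"
    "r \<in> measurable K (count_space UNIV)"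
  shows "(\<lambda>\<omega>. entry_from (r \<omega>) U (g \<omega>) (f \<omega>)) \<in> measurable K (count_space UNIV)"
  unfolding entry_from_def by (rule measurable_first_time) measurable

lemma measurable_ladder [measurable (raw)]:
  assumes [measurable]: "f \<in> measurable K S"
  shows "(\<lambda>\<omega>. ladder (f \<omega>)) \<in> measurable K (count_space UNIV)"
  unfolding ladder_def by measurable

lemma measurable_comb_at [measurable (raw)]:
  assumes [measurable]: "f \<in> measurable K S" "g \<in> measurable K S"
    "t \<in> measurable K (count_space UNIV)"
  shows "(\<lambda>\<omega>. comb_at (t \<omega>) (f \<omega>) (g \<omega>)) \<in> measurable K S"
proof (rule measurable_compose_countable[of "\<lambda>t \<omega>. comb_at t (f \<omega>) (g \<omega>)"])
  show "(\<lambda>\<omega>. comb_at s (f \<omega>) (g \<omega>)) \<in> measurable K S" for s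
    by (cases s) (auto simp: comb_at_def)
qed measurable

text \<open>
  Galmarino's test in place of a filtration: whether \<open>t\<close> equals \<open>n\<close> is decided by the first
  \<open>n\<close> coordinates.
\<close>

definition stopping :: "((nat \<Rightarrow> real) \<Rightarrow> enat) \<Rightarrow> bool" where
  "stopping t \<longleftrightarrow> t \<in> measurable S (count_space UNIV) \<and>
     (\<forall>n x y. t x = enat n \<longrightarrow> (\<forall>i<n. x i = y i) \<longrightarrow> t y = enat n)"

lemma stopping_measurable: "stopping t \<Longrightarrow> t \<in> measurable S (count_space UNIV)"
  by (simp add: stopping_def)

lemma stoppingD: "stopping t \<Longrightarrow> t x = enat n \<Longrightarrow> (\<And>i. i < n \<Longrightarrow> x i = y i) \<Longrightarrow> t y = enat n"
  unfolding stopping_def by blast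

lemma stopping_const: "stopping (\<lambda>x. c)"
  by (simp add: stopping_def)

lemma stopping_min:
  assumes s: "stopping s" and t: "stopping t"
  shows "stopping (\<lambda>x. min (s x) (t x))"
  unfolding stopping_def
proof (intro conjI allI impI)
  have m: "s \<in> measurable S (count_space UNIV)" "t \<in> measurable S (count_space UNIV)"
    using s t by (simp_all add: stopping_def)
  show "(\<lambda>x. min (s x) (t x)) \<in> measurable S (count_space UNIV)"
  proof (rule measurable_compose_countable[of "\<lambda>v x. min v (t x)", OF _ m(1)])
    show "(\<lambda>x. min v (t x)) \<in> measurable S (count_space UNIV)" for v
      by (rule measurable_compose[OF m(2)]) simp
  qed
  fix n x y
  assume *: "min (s x) (t x) = enat n" and agree: "\<forall>i<n. x i = y i"
  \<comment> \<open>If \<open>u\<close> stopped along \<open>y\<close> at some time before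
    \<open>n\<close>, it would stop along \<open>x\<close> at the same time, since the two paths
    agree up to \<open>n\<close>.\<close>
  have ge: "enat n \<le> u y" if u: "stopping u" "enat n \<le> u x" for u
  proof (cases "u y")
    case (enat m)
    show ?thesis
    proof (rule ccontr)
      assume "\<not> enat n \<le> u y"
      then have "m < n" using enat by simp
      then have "u x = enat m"
        using stoppingD[OF u(1) enat, of x] agree by simp
      then show False using u(2) \<open>m < n\<close> by simp
    qed
  qed simp
  have "enat n \<le> s x" "enat n \<le> t x"
    by (simp_all add: *[symmetric])
  then have le: "enat n \<le> s y" "enat n \<le> t y"
    using ge s t by auto
  show "min (s y) (t y) = enat n"
  proof (cases "s x \<le> t x")
    case True
    then have "s y = enat n" using * agree stoppingD[OF s, of x n y] by (simp add: min_absorb1)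
    then show ?thesis using le(2) by (simp add: min_absorb1)
  next
    case False
    then have "t y = enat n" using * agree stoppingD[OF t, of x n y] by (simp add: min_absorb2)
    then show ?thesis using le(1) by (simp add: min_absorb2)
  qed
qed

lemma stopping_entry_from:
  assumes [measurable]: "U \<in> sets borel"
  shows "stopping (entry_from r U z)"
  unfolding stopping_def
proof (intro conjI allI impI)
  show "entry_from r U z \<in> measurable S (count_space UNIV)"
    by measurable
  fix n x y assume *: "entry_from r U z x = enat n" "\<forall>i<n. x i = y i"
  have "psum x m = psum y m" if "m \<le> n" for m
    using * that by (intro psum_cong) auto
  then show "entry_from r U z y = enat n"
    using * by (auto simp: entry_from_eq_enat)
qed

lemma stopping_ladder: "stopping ladder"
  unfolding ladder_def[abs_def] by (rule stopping_entry_from) simp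

section \<open>Strong Markov property\<close>

lemma stopping_comb:
  assumes "stopping t" "t x = enat n"
  shows "t (comb_seq n x x') = enat n"
  using stoppingD[OF assms] by (simp add: comb_seq_def)

text \<open>There are countably many times, so the claim splits over the values of \<open>t\<close>.
  For a finite value \<open>n\<close> it is the invariance of \<open>S\<close> under
  \<open>comb_seq n\<close>; the event that \<open>t\<close> equals \<open>n\<close> is untouched by
  the splice, being decided by the first \<open>n\<close> steps.\<close>

lemma nn_integral_comb_at:
  assumes t: "stopping t" and F [measurable]: "F \<in> borel_measurable S"
  shows "(\<integral>\<^sup>+x. F x \<partial>S) = (\<integral>\<^sup>+x. \<integral>\<^sup>+x'. F (comb_at (t x) x x') \<partial>S \<partial>S)"
proof -
  have [measurable]: "t \<in> measurable S (count_space UNIV)"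
    using t by (simp add: stopping_def)
  have split: "G (t x) = (\<integral>\<^sup>+v. G v * indicator {t x} v \<partial>count_space UNIV)"
    for x and G :: "enat \<Rightarrow> ennreal"
    by simp
  have cnt: "(\<integral>\<^sup>+x. (\<integral>\<^sup>+v. G v x * indicator {t x} v \<partial>count_space UNIV) \<partial>S)
      = (\<integral>\<^sup>+v. (\<integral>\<^sup>+x. G v x * indicator {t x} v \<partial>S) \<partial>count_space UNIV)"
    if [measurable]: "\<And>v. G v \<in> borel_measurable S" for G :: "enat \<Rightarrow> (nat \<Rightarrow> real) \<Rightarrow> ennreal"
  proof (rule nn_integral_count_space_nn_integral)
    show "(\<lambda>x. G v x * indicator {t x} v) \<in> borel_measurable S" for v
    proof -
      have "(\<lambda>x. G v x * (if t x = v then 1 else 0)) \<in> borel_measurable S"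
        by measurable
      then show ?thesis
        by (rule back_subst[of "\<lambda>f. f \<in> borel_measurable S"]) (auto simp: indicator_def fun_eq_iff)
    qed
  qed simp
  have piece: "(\<integral>\<^sup>+x. F x * indicator {t x} v \<partial>S)
      = (\<integral>\<^sup>+x. (\<integral>\<^sup>+x'. F (comb_at v x x') \<partial>S) * indicator {t x} v \<partial>S)" for v
  proof (cases v)
    case (enat n)
    have I[measurable]: "(\<lambda>x. indicator {t x} v :: ennreal) \<in> borel_measurable S"
    proof -
      have "(\<lambda>x. (if t x = v then 1 else 0) :: ennreal) \<in> borel_measurable S"
        by measurable
      then show ?thesis
        by (rule back_subst[of "\<lambda>f. f \<in> borel_measurable S"]) (auto simp: indicator_def fun_eq_iff)
    qed
    have inv: "t (comb_seq n x x') = enat n \<longleftrightarrow> t x = enat n" for x x'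
      using stopping_comb[OF t] stoppingD[OF t, of "comb_seq n x x'" n x]
      by (auto simp: comb_seq_def)
    have "(\<integral>\<^sup>+x. F x * indicator {t x} v \<partial>S)
      = (\<integral>\<^sup>+x. F x * indicator {t x} v \<partial>distr (S \<Otimes>\<^sub>M S) S (\<lambda>(\<omega>, \<omega>'). comb_seq n \<omega> \<omega>'))"
      by (simp add: PiM_comb_seq)
    also have "\<dots> = (\<integral>\<^sup>+p. F (comb_seq n (fst p) (snd p)) *
        indicator {t (comb_seq n (fst p) (snd p))} v \<partial>(S \<Otimes>\<^sub>M S))"
      by (subst nn_integral_distr) (auto simp: case_prod_beta)
    also have "\<dots> = (\<integral>\<^sup>+x. \<integral>\<^sup>+x'. F (comb_seq n x x') * indicator {t (comb_seq n x x')} v \<partial>S \<partial>S)"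
      by (subst P.nn_integral_fst[symmetric]) auto
    also have "\<dots> = (\<integral>\<^sup>+x. \<integral>\<^sup>+x'. F (comb_seq n x x') * indicator {t x} v \<partial>S \<partial>S)"
      using inv by (intro nn_integral_cong) (simp add: enat indicator_def eq_commute[of "enat n"])
    also have "\<dots> = (\<integral>\<^sup>+x. (\<integral>\<^sup>+x'. F (comb_seq n x x') \<partial>S) * indicator {t x} v \<partial>S)"
      by (intro nn_integral_cong nn_integral_multc) simp
    finally show ?thesis using enat by simp
  next
    case infinity
    \<comment> \<open>Nothing is spliced here: the inner integrand is constant and the total mass is
      one.\<close>
    have "(\<integral>\<^sup>+x'. F (comb_at v x x') \<partial>S) = F x" for x
      unfolding infinity comb_at_def using P.emeasure_space_1 by simp
    then show ?thesis by (simp only:)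
  qed
  have "(\<integral>\<^sup>+x. F x \<partial>S) = (\<integral>\<^sup>+x. (\<integral>\<^sup>+v. F x * indicator {t x} v \<partial>count_space UNIV) \<partial>S)"
    by (subst split[symmetric]) simp
  also have "\<dots> = (\<integral>\<^sup>+v. (\<integral>\<^sup>+x. F x * indicator {t x} v \<partial>S) \<partial>count_space UNIV)"
    by (rule cnt) measurable
  also have "\<dots> = (\<integral>\<^sup>+v. (\<integral>\<^sup>+x. (\<integral>\<^sup>+x'. F (comb_at v x x') \<partial>S) * indicator {t x} v \<partial>S) \<partial>count_space UNIV)"
    by (simp only: piece)
  also have "\<dots> = (\<integral>\<^sup>+x. (\<integral>\<^sup>+v. (\<integral>\<^sup>+x'. F (comb_at v x x') \<partial>S) * indicator {t x} v \<partial>count_space UNIV) \<partial>S)"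
    by (rule cnt[symmetric]) measurable
  also have "\<dots> = (\<integral>\<^sup>+x. \<integral>\<^sup>+x'. F (comb_at (t x) x x') \<partial>S \<partial>S)"
    by (subst split[symmetric]) simp
  finally show ?thesis .
qed

lemma distr_comb_at:
  assumes t: "stopping t"
  shows "distr (S \<Otimes>\<^sub>M S) S (\<lambda>p. comb_at (t (fst p)) (fst p) (snd p)) = S" (is "?D = S")
proof (rule measure_eqI)
  fix A assume "A \<in> sets ?D"
  then have A [measurable]: "A \<in> sets S" by simp
  have [measurable]: "t \<in> measurable S (count_space UNIV)"
    using t by (simp add: stopping_def)
  have "emeasure ?D A = (\<integral>\<^sup>+p. indicator A (comb_at (t (fst p)) (fst p) (snd p)) \<partial>(S \<Otimes>\<^sub>M S))"
    by (subst nn_integral_indicator[symmetric], simp, subst nn_integral_distr) auto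
  also have "\<dots> = (\<integral>\<^sup>+x. \<integral>\<^sup>+x'. indicator A (comb_at (t x) x x') \<partial>S \<partial>S)"
    by (subst P.nn_integral_fst[symmetric]) auto
  also have "\<dots> = (\<integral>\<^sup>+x. indicator A x \<partial>S)"
    by (rule nn_integral_comb_at[OF t, symmetric]) measurable
  also have "\<dots> = emeasure S A" by simp
  finally show "emeasure ?D A = emeasure S A" .
qed simp

lemma integrable_comb_at:
  fixes F :: "(nat \<Rightarrow> real) \<Rightarrow> real"
  assumes t: "stopping t" and F: "integrable S F"
  shows "integrable (S \<Otimes>\<^sub>M S) (\<lambda>p. F (comb_at (t (fst p)) (fst p) (snd p)))"
proof -
  have [measurable]: "t \<in> measurable S (count_space UNIV)"
    using t by (simp add: stopping_def)
  show ?thesis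
    by (rule integrable_distr[of _ _ S]) (simp_all add: distr_comb_at[OF t] F)
qed

lemma integral_comb_at:
  fixes F :: "(nat \<Rightarrow> real) \<Rightarrow> real"
  assumes t: "stopping t" and F: "integrable S F"
  shows "(\<integral>x. F x \<partial>S) = (\<integral>p. F (comb_at (t (fst p)) (fst p) (snd p)) \<partial>(S \<Otimes>\<^sub>M S))"
proof -
  have [measurable]: "t \<in> measurable S (count_space UNIV)"
    using t by (simp add: stopping_def)
  have [measurable]: "F \<in> borel_measurable S" using F by simp
  have "(\<integral>x. F x \<partial>distr (S \<Otimes>\<^sub>M S) S (\<lambda>p. comb_at (t (fst p)) (fst p) (snd p)))
      = (\<integral>p. F (comb_at (t (fst p)) (fst p) (snd p)) \<partial>(S \<Otimes>\<^sub>M S))"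
    by (rule integral_distr) simp_all
  then show ?thesis
    by (simp only: distr_comb_at[OF t])
qed

end

subsection \<open>First entry times of rays\<close>

context step_space
begin

text \<open>The formula for the spliced path is demanded only for almost all continuations, because
  in the applications it involves entry times of the continuation, and these are finite only almost
  surely.\<close>

lemma integral_markov:
  fixes F :: "(nat \<Rightarrow> real) \<Rightarrow> real"
  assumes t: "stopping t" and fin: "AE x in S. t x \<noteq> \<infinity>" and F: "integrable S F"
    and G [measurable]: "(\<lambda>p. G (fst p) (snd p)) \<in> borel_measurable (S \<Otimes>\<^sub>M S)"
    and FG: "AE x in S. AE x' in S. \<forall>n. t x = enat n \<longrightarrow> F (comb_seq n x x') = G x x'"
  shows "integrable S (\<lambda>x. \<integral>x'. G x x' \<partial>S)" "(\<integral>x. F x \<partial>S) = (\<integral>x. \<integral>x'. G x x' \<partial>S \<partial>S)"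
proof -
  interpret pair_sigma_finite S S ..
  have [measurable]: "t \<in> measurable S (count_space UNIV)" "F \<in> borel_measurable S"
    using t F by (simp_all add: stopping_def)
  have "AE x in S. AE x' in S. F (comb_at (t x) x x') = G x x'"
    using fin FG
  proof eventually_elim
    case (elim x)
    then obtain n where "t x = enat n" by auto
    then show ?case using elim(2) by simp
  qed
  then have ae: "AE p in S \<Otimes>\<^sub>M S. F (comb_at (t (fst p)) (fst p) (snd p)) = G (fst p) (snd p)"
    by (intro AE_pair_measure) simp_all
  have GI: "integrable (S \<Otimes>\<^sub>M S) (\<lambda>p. G (fst p) (snd p))"
    using integrable_comb_at[OF t F] by (rule integrable_cong_AE_imp) (use ae in measurable)
  from integrable_fst'[OF GI] show "integrable S (\<lambda>x. \<integral>x'. G x x' \<partial>S)"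
    by simp
  have "(\<integral>x. F x \<partial>S) = (\<integral>p. G (fst p) (snd p) \<partial>(S \<Otimes>\<^sub>M S))"
    unfolding integral_comb_at[OF t F] by (rule integral_cong_AE[OF _ _ ae]) measurable
  also have "\<dots> = (\<integral>x. \<integral>x'. G x x' \<partial>S \<partial>S)"
    using integral_fst'[OF GI] by simp
  finally show "(\<integral>x. F x \<partial>S) = (\<integral>x. \<integral>x'. G x x' \<partial>S \<partial>S)" .
qed

end

text \<open>Open and closed rays in one notion. The last clause bounds the complement from above,
  which makes ladder costs from outside the ray uniformly bounded.\<close>

definition upper_ray :: "real set \<Rightarrow> bool" where
  "upper_ray U \<longleftrightarrow> U \<in> sets borel \<and> (\<forall>u\<in>U. \<forall>v\<ge>u. v \<in> U) \<and> (\<exists>a. {a<..} \<subseteq> U)"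

lemma upper_ray_greaterThan [simp]: "upper_ray {a<..}"
  by (auto simp: upper_ray_def)

lemma upper_ray_atLeast [simp]: "upper_ray {a..}"
  by (auto simp: upper_ray_def intro!: exI[of _ a])

lemma upper_ray_sets: "upper_ray U \<Longrightarrow> U \<in> sets borel"
  by (simp add: upper_ray_def)

lemma upper_rayD: "upper_ray U \<Longrightarrow> u \<in> U \<Longrightarrow> u \<le> v \<Longrightarrow> v \<in> U"
  by (auto simp: upper_ray_def)

lemma upper_ray_notin: "upper_ray U \<Longrightarrow> v \<notin> U \<Longrightarrow> u \<le> v \<Longrightarrow> u \<notin> U"
  by (auto simp: upper_ray_def)

abbreviation etime :: "real set \<Rightarrow> real \<Rightarrow> (nat \<Rightarrow> real) \<Rightarrow> nat" where
  "etime U z x \<equiv> the_enat (entry U z x)"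

abbreviation ltime :: "(nat \<Rightarrow> real) \<Rightarrow> nat" where
  "ltime x \<equiv> the_enat (ladder x)"

text \<open>Cost up to time \<open>n\<close> of the walk stopped on entering \<open>U\<close>. The
  truncation allows an induction on \<open>n\<close> before the entry time is known to be finite.
  Visits are tested up to index \<open>i\<close> and the position at \<open>Suc i\<close> is
  charged, so the entry position is still paid for.\<close>

definition trunc_cost :: "(real \<Rightarrow> real) \<Rightarrow> real set \<Rightarrow> real \<Rightarrow> nat \<Rightarrow> (nat \<Rightarrow> real) \<Rightarrow> real" where
  "trunc_cost k U z n x =
     (\<Sum>i<n. k (z + psum x (Suc i)) * (if \<forall>j\<le>i. z + psum x j \<notin> U then 1 else 0))"

lemma trunc_cost_in: "z \<in> U \<Longrightarrow> trunc_cost k U z n x = 0"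
  unfolding trunc_cost_def by (rule sum.neutral) (auto intro!: exI[of _ "0::nat"])

lemma trunc_cost_nonneg: "(\<And>u. k u \<ge> 0) \<Longrightarrow> trunc_cost k U z n x \<ge> 0"
  unfolding trunc_cost_def by (rule sum_nonneg) auto

lemma trunc_cost_mono: "(\<And>u. k u \<ge> 0) \<Longrightarrow> m \<le> n \<Longrightarrow> trunc_cost k U z m x \<le> trunc_cost k U z n x"
  unfolding trunc_cost_def by (rule sum_mono2) auto

lemma trunc_cost_entry:
  assumes "entry U z x = enat m"
  shows "trunc_cost k U z m x = cost k z x m"
  unfolding trunc_cost_def cost_def using assms
  by (intro sum.cong) (auto simp: entry_eq_enat)

text \<open>Since \<open>j \<ge> 1\<close>, at most \<open>n\<close> of the \<open>Suc n\<close>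
  steps are left after the splice; this drives the induction on \<open>n\<close>. The estimate
  charges the first \<open>j\<close> steps in full and afterwards tests only visits from time
  \<open>j\<close> on.\<close>

lemma trunc_cost_comb:
  assumes k: "\<And>u. k u \<ge> 0" and "j \<ge> 1"
  shows "trunc_cost k U z (Suc n) (comb_seq j x x') \<le> cost k z x j + trunc_cost k U (z + psum x j) n x'"
proof -
  let ?y = "comb_seq j x x'"
  let ?f = "\<lambda>i. k (z + psum ?y (Suc i)) * (if \<forall>j\<le>i. z + psum ?y j \<notin> U then 1 else 0)"
  have "trunc_cost k U z (Suc n) ?y \<le> sum ?f ({..<j} \<union> (+) j ` {..<n})"
    unfolding trunc_cost_def
  proof (rule sum_mono2)
    show "{..<Suc n} \<subseteq> {..<j} \<union> (+) j ` {..<n}"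
    proof
      fix i assume "i \<in> {..<Suc n}"
      then have "i < Suc n" by simp
      show "i \<in> {..<j} \<union> (+) j ` {..<n}"
      proof (cases "i < j")
        case False
        then have "i = j + (i - j)" "i - j < n" using \<open>i < Suc n\<close> \<open>j \<ge> 1\<close> by auto
        then show ?thesis by blast
      qed simp
    qed
  qed (use k in auto)
  also have "\<dots> = sum ?f {..<j} + sum ?f ((+) j ` {..<n})"
    by (rule sum.union_disjoint) auto
  also have "sum ?f {..<j} \<le> cost k z x j"
    unfolding cost_def using k by (intro sum_mono) (auto simp: psum_comb_le)
  also have "sum ?f ((+) j ` {..<n}) = (\<Sum>i<n. ?f (j + i))"
    by (subst sum.reindex) (auto simp: inj_on_def)
  also have "\<dots> \<le> trunc_cost k U (z + psum x j) n x'"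
    unfolding trunc_cost_def
  proof (rule sum_mono)
    fix i
    have *: "\<forall>l\<le>i. z + psum x j + psum x' l \<notin> U" if "\<forall>l\<le>j + i. z + psum ?y l \<notin> U"
    proof (intro allI impI)
      fix l assume "l \<le> i"
      then show "z + psum x j + psum x' l \<notin> U"
        using that[rule_format, of "j + l"] by (simp add: psum_comb_add add.assoc)
    qed
    have "psum ?y (Suc (j + i)) = psum x j + psum x' (Suc i)"
      using psum_comb_add[of j x x' "Suc i"] by simp
    then show "?f (j + i) \<le> k (z + psum x j + psum x' (Suc i)) * (if \<forall>l\<le>i. z + psum x j + psum x' l \<notin> U then 1 else 0)"
      using * k by (auto simp: add.assoc)
  qed
  finally show ?thesis by simp
qed

text \<open>The hypotheses of the theorem on path space. As \<open>ennreal\<close> maps negative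
  numbers to \<open>0\<close>, \<open>sup_finite\<close> concerns the positive part of the
  supremum.\<close>

locale walk_problem = step_space +
  fixes \<gamma> h :: "real \<Rightarrow> real"
  assumes mono_gamma: "mono \<gamma>" and mono_h: "mono h" and h_nonneg: "h u \<ge> 0"
    and mean_ladder_finite: "(\<integral>\<^sup>+x. ennreal_of_enat (ladder x) \<partial>S) < \<infinity>"
    and integrable_reward: "integrable S (\<lambda>x. \<gamma> (y + ladder_height x))"
    and integrable_lcost: "integrable S (\<lambda>x. cost h y x (ltime x))"
    and sup_finite: "(\<integral>\<^sup>+x. (SUP n. ennreal (pay \<gamma> h y x n)) \<partial>S) < \<infinity>"
begin

lemma gamma_measurable [measurable]: "\<gamma> \<in> borel_measurable borel"
  using mono_gamma by (rule borel_measurable_mono)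

lemma h_measurable [measurable]: "h \<in> borel_measurable borel"
  using mono_h by (rule borel_measurable_mono)

lemma h_cost_nonneg: "cost h z x n \<ge> 0"
  by (rule cost_nonneg) (rule h_nonneg)

lemma AE_ladder_finite: "AE x in S. ladder x \<noteq> \<infinity>"
proof -
  have "AE x in S. ennreal_of_enat (ladder x) \<noteq> \<infinity>"
    by (rule nn_integral_PInf_AE) (use mean_ladder_finite in auto)
  then show ?thesis
    by eventually_elim (metis ennreal_of_enat_infty infinity_ennreal_def)
qed

lemma AE_ladder_height_pos: "AE x in S. ladder_height x > 0"
  using AE_ladder_finite
proof eventually_elim
  case (elim x)
  then obtain n where "ladder x = enat n" by auto
  then show ?case using ladder_eq_enat[of x n] by simp
qed

lemma integrable_ltime: "integrable S (\<lambda>x. real (ltime x))"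
proof (rule integrableI_bounded)
  have "(\<integral>\<^sup>+x. ennreal (norm (real (ltime x))) \<partial>S) = (\<integral>\<^sup>+x. ennreal_of_enat (ladder x) \<partial>S)"
    using AE_ladder_finite
    by (intro nn_integral_cong_AE) (auto elim!: eventually_mono simp: ennreal_of_nat_eq_real_of_nat)
  then show "(\<integral>\<^sup>+x. ennreal (norm (real (ltime x))) \<partial>S) < \<infinity>"
    using mean_ladder_finite by simp
qed measurable

section \<open>Costs up to the entry into a ray\<close>

definition theta :: real where
  "theta = (\<integral>x. exp (- ladder_height x) \<partial>S)"

lemma integrable_exp_height: "integrable S (\<lambda>x. exp (- ladder_height x))"
proof (rule P.integrable_const_bound[of _ 1])
  show "AE x in S. norm (exp (- ladder_height x)) \<le> 1"
    using AE_ladder_height_pos by eventually_elim simp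
qed measurable

lemma theta_nonneg: "theta \<ge> 0"
  unfolding theta_def by (rule Bochner_Integration.integral_nonneg) simp

text \<open>The ladder height is almost surely positive, so
  \<open>1 - exp (- ladder_height x)\<close> is almost surely positive and cannot have mean
  zero.\<close>

lemma theta_less_1: "theta < 1"
proof -
  have I: "integrable S (\<lambda>x. 1 - exp (- ladder_height x))"
    using integrable_exp_height by simp
  have nonneg: "AE x in S. 0 \<le> 1 - exp (- ladder_height x)"
    using AE_ladder_height_pos by eventually_elim simp
  have eq: "(\<integral>x. 1 - exp (- ladder_height x) \<partial>S) = 1 - theta"
    unfolding theta_def using integrable_exp_height P.prob_space by simp
  have "1 - theta \<ge> 0"
    using integral_nonneg_AE[OF nonneg] eq by simp
  moreover have "1 - theta \<noteq> 0"
  proof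
    assume "1 - theta = 0"
    then have "AE x in S. 1 - exp (- ladder_height x) = 0"
      using integral_nonneg_eq_0_iff_AE[OF I nonneg] eq by simp
    with AE_ladder_height_pos have "AE x in S. False"
      by eventually_elim simp
    then show False by simp
  qed
  ultimately show ?thesis by simp
qed

lemma measurable_trunc_cost:
  assumes [measurable]: "k \<in> borel_measurable borel" "U \<in> sets borel" "f \<in> measurable K S" "g \<in> borel_measurable K"
  shows "(\<lambda>\<omega>. trunc_cost k U (g \<omega>) n (f \<omega>)) \<in> borel_measurable K"
  unfolding trunc_cost_def by measurable

text \<open>
  The weight \<open>exp (- z)\<close> turns the recursion along the ladder heights into a contraction
  with factor \<open>theta = E (exp (- ladder_height)) < 1\<close>, so no renewal theory is needed.
\<close>

lemma trunc_cost_bound: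
  assumes U: "upper_ray U" and k: "mono k" "\<And>u. k u \<ge> 0"
    and kI: "\<And>y. integrable S (\<lambda>x. cost k y x (ltime x))"
  obtains K where "K \<ge> 0"
    "\<And>z n. z \<notin> U \<Longrightarrow> (\<integral>\<^sup>+x. ennreal (trunc_cost k U z n x) \<partial>S) \<le> ennreal (K * exp (- z))"
proof -
  have [measurable]: "k \<in> borel_measurable borel"
    using k(1) by (rule borel_measurable_mono)
  have [measurable]: "U \<in> sets borel"
    using U by (rule upper_ray_sets)
  obtain a where a: "{a<..} \<subseteq> U"
    using U by (auto simp: upper_ray_def)
  \<comment> \<open>Every point outside \<open>U\<close> is at most \<open>a\<close>, so by
    monotonicity \<open>b\<close> bounds the mean ladder cost from all of them. \<open>K\<close>
    solves \<open>b * exp a = (1 - theta) * K\<close>, and \<open>exp (a - z) \<ge> 1\<close> then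
    closes the induction.\<close>
  define b where "b = (\<integral>x. cost k a x (ltime x) \<partial>S)"
  define K where "K = b * exp a / (1 - theta)"
  have b: "b \<ge> 0"
    unfolding b_def using k by (intro Bochner_Integration.integral_nonneg cost_nonneg)
  have K: "K \<ge> 0"
    unfolding K_def using b theta_less_1 by simp
  have bound: "(\<integral>\<^sup>+x. ennreal (trunc_cost k U z n x) \<partial>S) \<le> ennreal (K * exp (- z))" if "z \<notin> U" for z n
    using that
  proof (induction n arbitrary: z)
    case 0
    then show ?case by (simp add: trunc_cost_def)
  next
    case (Suc n)
    have za: "z \<le> a" using a Suc.prems by force
    note [measurable] = measurable_trunc_cost
    have "(\<integral>\<^sup>+x. ennreal (trunc_cost k U z (Suc n) x) \<partial>S)
        = (\<integral>\<^sup>+x. \<integral>\<^sup>+x'. ennreal (trunc_cost k U z (Suc n) (comb_at (ladder x) x x')) \<partial>S \<partial>S)"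
      by (rule nn_integral_comb_at[OF stopping_ladder]) measurable
    also have "\<dots> \<le> (\<integral>\<^sup>+x. ennreal (cost k z x (ltime x)) + ennreal (K * exp (- z)) * ennreal (exp (- ladder_height x)) \<partial>S)"
    proof (rule nn_integral_mono_AE)
      show "AE x in S. (\<integral>\<^sup>+x'. ennreal (trunc_cost k U z (Suc n) (comb_at (ladder x) x x')) \<partial>S)
        \<le> ennreal (cost k z x (ltime x)) + ennreal (K * exp (- z)) * ennreal (exp (- ladder_height x))"
        using AE_ladder_finite
      proof eventually_elim
        case (elim x)
        then obtain j where j: "ladder x = enat j" by auto
        have j1: "j \<ge> 1" using ladder_ge_1[of x] j by (simp add: one_enat_def)
        \<comment> \<open>Inside \<open>U\<close> the truncated cost is zero, so the bound also
          covers ladder positions that land in \<open>U\<close>.\<close>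
        have IH: "(\<integral>\<^sup>+x'. ennreal (trunc_cost k U (z + psum x j) n x') \<partial>S) \<le> ennreal (K * exp (- (z + psum x j)))"
          using Suc.IH[of "z + psum x j"] by (cases "z + psum x j \<in> U") (auto simp: trunc_cost_in)
        have "(\<integral>\<^sup>+x'. ennreal (trunc_cost k U z (Suc n) (comb_at (ladder x) x x')) \<partial>S)
          \<le> (\<integral>\<^sup>+x'. ennreal (cost k z x j) + ennreal (trunc_cost k U (z + psum x j) n x') \<partial>S)"
          using trunc_cost_comb[OF k(2) j1] trunc_cost_nonneg[OF k(2)] cost_nonneg[OF k(2)]
          by (intro nn_integral_mono) (simp add: j flip: ennreal_plus)
        also have "\<dots> = ennreal (cost k z x j) + (\<integral>\<^sup>+x'. ennreal (trunc_cost k U (z + psum x j) n x') \<partial>S)"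
          by (subst nn_integral_add) (auto simp: P.emeasure_space_1[simplified])
        also have "\<dots> \<le> ennreal (cost k z x j) + ennreal (K * exp (- (z + psum x j)))"
          using IH by (rule add_left_mono)
        also have "ennreal (K * exp (- (z + psum x j))) = ennreal (K * exp (- z)) * ennreal (exp (- ladder_height x))"
          using K by (simp add: j exp_diff exp_minus field_simps flip: ennreal_mult)
        finally show ?case
          by (simp add: j)
      qed
    qed
    also have "\<dots> = ennreal (\<integral>x. cost k z x (ltime x) \<partial>S) + ennreal (K * exp (- z)) * ennreal theta"
      unfolding theta_def using k integrable_exp_height
      by (subst nn_integral_add, simp, simp, subst nn_integral_cmult)
        (auto simp: nn_integral_eq_integral kI cost_nonneg)
    also have "\<dots> \<le> ennreal b + ennreal (K * exp (- z)) * ennreal theta"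
      unfolding b_def using za
      by (intro add_right_mono ennreal_leI integral_mono kI cost_mono_start k)
    also have "\<dots> = ennreal (b + K * exp (- z) * theta)"
      using b K theta_nonneg by (simp flip: ennreal_mult)
    also have "\<dots> \<le> ennreal (K * exp (- z))"
    proof (rule ennreal_leI)
      have "b \<le> b * (exp a * exp (- z))"
        using b za by (simp add: mult_le_cancel_left1 flip: exp_add)
      also have "\<dots> = (1 - theta) * (K * exp (- z))"
        unfolding K_def using theta_less_1 by simp
      finally show "b + K * exp (- z) * theta \<le> K * exp (- z)"
        by (simp add: algebra_simps)
    qed
    finally show ?case .
  qed
  show ?thesis
    using that[OF K bound] .
qed

lemma entry_cost_bound:
  assumes U: "upper_ray U" and k: "mono k" "\<And>u. k u \<ge> 0"
    and kI: "\<And>y. integrable S (\<lambda>x. cost k y x (ltime x))"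
  obtains K where "K \<ge> 0"
    "\<And>z. z \<notin> U \<Longrightarrow> (\<integral>\<^sup>+x. (SUP n. ennreal (trunc_cost k U z n x)) \<partial>S) \<le> ennreal (K * exp (- z))"
proof -
  have [measurable]: "k \<in> borel_measurable borel"
    using k(1) by (rule borel_measurable_mono)
  have [measurable]: "U \<in> sets borel"
    using U by (rule upper_ray_sets)
  note [measurable] = measurable_trunc_cost
  obtain K where K: "K \<ge> 0"
    "\<And>z n. z \<notin> U \<Longrightarrow> (\<integral>\<^sup>+x. ennreal (trunc_cost k U z n x) \<partial>S) \<le> ennreal (K * exp (- z))"
    by (rule trunc_cost_bound[OF assms]) auto
  have "(\<integral>\<^sup>+x. (SUP n. ennreal (trunc_cost k U z n x)) \<partial>S) \<le> ennreal (K * exp (- z))" if "z \<notin> U" for z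
  proof -
    have "incseq (\<lambda>n x. ennreal (trunc_cost k U z n x))"
      using k(2) by (intro incseq_SucI le_funI ennreal_leI trunc_cost_mono) auto
    then have "(\<integral>\<^sup>+x. (SUP n. ennreal (trunc_cost k U z n x)) \<partial>S) = (SUP n. (\<integral>\<^sup>+x. ennreal (trunc_cost k U z n x) \<partial>S))"
      by (rule nn_integral_monotone_convergence_SUP) measurable
    also have "\<dots> \<le> ennreal (K * exp (- z))"
      using K(2)[OF that] by (rule SUP_least)
    finally show ?thesis .
  qed
  then show ?thesis using that[OF K(1)] by blast
qed

text \<open>With unit cost, a path that never enters \<open>U\<close> has truncated cost
  \<open>n\<close> for every \<open>n\<close>, so its supremum is infinite. The supremum has finite
  mean, hence such paths form a null set.\<close>

lemma AE_entry_finite: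
  assumes U: "upper_ray U"
  shows "AE x in S. entry U z x \<noteq> \<infinity>"
proof (cases "z \<in> U")
  case True
  then have "entry U z x = enat 0" for x by (simp add: entry_eq_enat)
  then show ?thesis by simp
next
  case False
  have [measurable]: "U \<in> sets borel"
    using U by (rule upper_ray_sets)
  have one: "cost (\<lambda>_. 1) y x n = real n" for y x n by (simp add: cost_def)
  obtain K where K: "K \<ge> 0"
    "\<And>z. z \<notin> U \<Longrightarrow> (\<integral>\<^sup>+x. (SUP n. ennreal (trunc_cost (\<lambda>_. 1) U z n x)) \<partial>S) \<le> ennreal (K * exp (- z))"
    using entry_cost_bound[OF U, of "\<lambda>_. 1"] integrable_ltime by (auto simp: mono_def one)
  have "AE x in S. (SUP n. ennreal (trunc_cost (\<lambda>_. 1) U z n x)) \<noteq> \<infinity>"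
  proof (rule nn_integral_PInf_AE)
    note [measurable] = measurable_trunc_cost
    show "(\<lambda>x. (SUP n. ennreal (trunc_cost (\<lambda>_. 1) U z n x))) \<in> borel_measurable S"
      by measurable
    show "(\<integral>\<^sup>+x. (SUP n. ennreal (trunc_cost (\<lambda>_. 1) U z n x)) \<partial>S) \<noteq> \<infinity>"
      using le_less_trans[OF K(2)[OF False] ennreal_less_top] by simp
  qed
  then show ?thesis
  proof eventually_elim
    case (elim x)
    show ?case
    proof
      assume "entry U z x = \<infinity>"
      then have "\<forall>n. z + psum x n \<notin> U"
        by (simp add: entry_from_def first_time_eq_infinity)
      then have "trunc_cost (\<lambda>_. 1) U z n x = real n" for n
        by (simp add: trunc_cost_def)
      then have "(SUP n. ennreal (trunc_cost (\<lambda>_. 1) U z n x)) = (SUP n. of_nat n)"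
        by (simp add: ennreal_of_nat_eq_real_of_nat)
      also have "\<dots> = (\<infinity> :: ennreal)"
        using ennreal_SUP_of_nat_eq_top by simp
      finally show False using elim by simp
    qed
  qed
qed

lemma etime_in:
  assumes "entry U z x \<noteq> \<infinity>"
  shows "z + psum x (etime U z x) \<in> U"
proof -
  obtain n where n: "entry U z x = enat n" using assms by auto
  then show ?thesis using entry_eq_enat[of U z x n] by simp
qed

lemma entry_in_0: "z \<in> U \<Longrightarrow> entry U z x = enat 0"
  by (simp add: entry_eq_enat)

text \<open>At an almost surely finite entry time the full cost is one of the truncated costs. That
  \<open>K\<close> is uniform in the starting point matters: the iteration in
  \<open>gamma_le_entry_pay\<close> starts from this bound.\<close>

lemma cost_etime_bound:
  assumes U: "upper_ray U" and k: "mono k" "\<And>u. k u \<ge> 0"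
    and kI: "\<And>y. integrable S (\<lambda>x. cost k y x (ltime x))"
  shows "integrable S (\<lambda>x. cost k z x (etime U z x))"
    and "\<exists>K\<ge>0. \<forall>z. z \<notin> U \<longrightarrow> (\<integral>x. cost k z x (etime U z x) \<partial>S) \<le> K * exp (- z)"
proof -
  have [measurable]: "k \<in> borel_measurable borel"
    using k(1) by (rule borel_measurable_mono)
  have [measurable]: "U \<in> sets borel"
    using U by (rule upper_ray_sets)
  obtain K where K: "K \<ge> 0"
    "\<And>z. z \<notin> U \<Longrightarrow> (\<integral>\<^sup>+x. (SUP n. ennreal (trunc_cost k U z n x)) \<partial>S) \<le> ennreal (K * exp (- z))"
    by (rule entry_cost_bound[OF assms]) auto
  have le: "(\<integral>\<^sup>+x. ennreal (cost k z x (etime U z x)) \<partial>S) \<le> ennreal (K * exp (- z))" if "z \<notin> U" for z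
  proof -
    have "(\<integral>\<^sup>+x. ennreal (cost k z x (etime U z x)) \<partial>S) \<le> (\<integral>\<^sup>+x. (SUP n. ennreal (trunc_cost k U z n x)) \<partial>S)"
    proof (rule nn_integral_mono_AE)
      show "AE x in S. ennreal (cost k z x (etime U z x)) \<le> (SUP n. ennreal (trunc_cost k U z n x))"
        using AE_entry_finite[OF U, of z]
      proof eventually_elim
        case (elim x)
        then obtain m where m: "entry U z x = enat m" by auto
        then have "cost k z x (etime U z x) = trunc_cost k U z m x"
          by (simp add: trunc_cost_entry)
        then show ?case by (auto intro: SUP_upper)
      qed
    qed
    then show ?thesis using K(2)[OF that] by (rule order_trans)
  qed
  show *: "integrable S (\<lambda>x. cost k z x (etime U z x))" for z
  proof (cases "z \<in> U")
    case True
    then show ?thesis by (simp add: entry_in_0)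
  next
    case False
    show ?thesis
    proof (rule integrableI_bounded)
      show "(\<integral>\<^sup>+x. ennreal (norm (cost k z x (etime U z x))) \<partial>S) < \<infinity>"
        using le[OF False] cost_nonneg[OF k(2)] by (simp add: le_less_trans)
    qed measurable
  qed
  have "(\<integral>x. cost k z x (etime U z x) \<partial>S) \<le> K * exp (- z)" if "z \<notin> U" for z
  proof -
    have "ennreal (\<integral>x. cost k z x (etime U z x) \<partial>S) \<le> ennreal (K * exp (- z))"
      using le[OF that] nn_integral_eq_integral[OF *, of z] cost_nonneg[OF k(2)] by simp
    then show ?thesis
      using K(1) by (simp add: ennreal_le_iff)
  qed
  then show "\<exists>K\<ge>0. \<forall>z. z \<notin> U \<longrightarrow> (\<integral>x. cost k z x (etime U z x) \<partial>S) \<le> K * exp (- z)"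
    using K(1) by blast
qed

lemmas integrable_cost_etime = cost_etime_bound(1)[OF _ mono_h h_nonneg integrable_lcost]
lemmas cost_etime_le = cost_etime_bound(2)[OF _ mono_h h_nonneg integrable_lcost]

lemma integrable_etime:
  assumes "upper_ray U"
  shows "integrable S (\<lambda>x. real (etime U z x))"
proof -
  have one: "cost (\<lambda>_. 1) y x n = real n" for y x n by (simp add: cost_def)
  show ?thesis
    using cost_etime_bound(1)[OF assms, of "\<lambda>_. 1" z] integrable_ltime by (auto simp: mono_def one)
qed

text \<open>A ray is entered from outside at or above \<open>z\<close>, which bounds the reward
  below by \<open>\<gamma> z\<close>. From above, the reward is pay-off plus cost, and the pay-off
  is at most the supremum in \<open>sup_finite\<close>.\<close>

lemma integrable_gamma_etime:
  assumes U: "upper_ray U"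
  shows "integrable S (\<lambda>x. \<gamma> (z + psum x (etime U z x)))"
proof (cases "z \<in> U")
  case True
  then show ?thesis by (simp add: entry_in_0)
next
  case False
  have [measurable]: "U \<in> sets borel"
    using U by (rule upper_ray_sets)
  define s where "s x = (SUP n. ennreal (pay \<gamma> h z x n))" for x
  have [measurable]: "s \<in> borel_measurable S"
    unfolding s_def by measurable
  have "(\<integral>\<^sup>+x. ennreal (norm (\<gamma> (z + psum x (etime U z x)))) \<partial>S)
      \<le> (\<integral>\<^sup>+x. ennreal \<bar>\<gamma> z\<bar> + (s x + ennreal (cost h z x (etime U z x))) \<partial>S)"
  proof (rule nn_integral_mono_AE)
    show "AE x in S. ennreal (norm (\<gamma> (z + psum x (etime U z x))))
      \<le> ennreal \<bar>\<gamma> z\<bar> + (s x + ennreal (cost h z x (etime U z x)))"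
      using AE_entry_finite[OF U, of z]
    proof eventually_elim
      case (elim x)
      let ?t = "etime U z x"
      have in_U: "z + psum x ?t \<in> U" using elim by (rule etime_in)
      have "z \<le> z + psum x ?t"
        using upper_rayD[OF U in_U, of z] False by linarith
      then have ge: "\<gamma> z \<le> \<gamma> (z + psum x ?t)"
        by (rule monoD[OF mono_gamma])
      have "norm (\<gamma> (z + psum x ?t)) \<le> \<bar>\<gamma> z\<bar> + (max 0 (pay \<gamma> h z x ?t) + cost h z x ?t)"
        using ge h_cost_nonneg[of z x ?t] by (simp add: pay_def)
      then have "ennreal (norm (\<gamma> (z + psum x ?t))) \<le> ennreal (\<bar>\<gamma> z\<bar> + (max 0 (pay \<gamma> h z x ?t) + cost h z x ?t))"
        by (rule ennreal_leI)
      also have "\<dots> = ennreal \<bar>\<gamma> z\<bar> + (ennreal (pay \<gamma> h z x ?t) + ennreal (cost h z x ?t))"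
        using h_cost_nonneg[of z x ?t] by (simp add: ennreal_max_0)
      also have "\<dots> \<le> ennreal \<bar>\<gamma> z\<bar> + (s x + ennreal (cost h z x ?t))"
        unfolding s_def by (intro add_left_mono add_right_mono SUP_upper) simp
      finally show ?case .
    qed
  qed
  also have "\<dots> = ennreal \<bar>\<gamma> z\<bar> + ((\<integral>\<^sup>+x. s x \<partial>S) + (\<integral>\<^sup>+x. ennreal (cost h z x (etime U z x)) \<partial>S))"
    by (subst nn_integral_add, simp, simp, subst nn_integral_add) (auto simp: P.emeasure_space_1[simplified])
  also have "\<dots> < \<infinity>"
  proof -
    have "(\<integral>\<^sup>+x. ennreal (cost h z x (etime U z x)) \<partial>S) < \<infinity>"
      using integrable_cost_etime[OF U, of z] h_cost_nonneg by (simp add: nn_integral_eq_integral)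
    moreover have "(\<integral>\<^sup>+x. s x \<partial>S) < \<infinity>"
      unfolding s_def by (rule sup_finite)
    ultimately show ?thesis by (simp add: less_top)
  qed
  finally show ?thesis
    by (intro integrableI_bounded) measurable
qed

lemma integrable_pay_etime:
  assumes "upper_ray U"
  shows "integrable S (\<lambda>x. pay \<gamma> h z x (etime U z x))"
  unfolding pay_def using integrable_gamma_etime[OF assms] integrable_cost_etime[OF assms] by simp

end

subsection \<open>Waiting for the stopping set\<close>

text \<open>The points \<open>v\<close> and \<open>u + s\<close> are convex combinations of
  \<open>u\<close> and \<open>v + s\<close> with exchanged weights; the sum of the two concavity
  inequalities is the claim. \<open>D\<close> is the length of the interval and
  \<open>p = s / D\<close> the weight.\<close>

lemma concave_on_increment_antimono:
  fixes \<gamma> :: "real \<Rightarrow> real"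
  assumes conc: "concave_on {b..} \<gamma>" and "b \<le> u" "u \<le> v" "s \<ge> 0"
  shows "\<gamma> (v + s) - \<gamma> v \<le> \<gamma> (u + s) - \<gamma> u"
proof (cases "s + (v - u) = 0")
  case True
  then have "s = 0" "v = u" using assms by linarith+
  then show ?thesis by simp
next
  case False
  define D where "D = s + (v - u)"
  have D: "D > 0" using False assms by (simp add: D_def)
  define p where "p = s / D"
  have p: "0 \<le> p" "p \<le> 1" using D assms by (auto simp: p_def D_def)
  have Dp: "D * p = s" using D by (simp add: p_def)
  have c: "p' * \<gamma> u + (1 - p') * \<gamma> (v + s) \<le> \<gamma> (p' * u + (1 - p') * (v + s))"
    if "0 \<le> p'" "p' \<le> 1" for p'
    using conc that assms by (auto simp: concave_on_iff)
  have e1: "p * u + (1 - p) * (v + s) = v"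
  proof -
    have "p * u + (1 - p) * (v + s) = v + s - D * p" by (simp add: D_def algebra_simps)
    then show ?thesis using Dp by simp
  qed
  have e2: "(1 - p) * u + p * (v + s) = u + s"
  proof -
    have "(1 - p) * u + p * (v + s) = u + D * p" by (simp add: D_def algebra_simps)
    then show ?thesis using Dp by simp
  qed
  have "p * \<gamma> u + (1 - p) * \<gamma> (v + s) \<le> \<gamma> v"
    using c[of p] p unfolding e1 by simp
  moreover have "(1 - p) * \<gamma> u + p * \<gamma> (v + s) \<le> \<gamma> (u + s)"
    using c[of "1 - p"] p e2 by simp
  ultimately show ?thesis
    by (simp add: algebra_simps)
qed

context walk_problem
begin

definition phi :: "real \<Rightarrow> real" where
  "phi y = (\<integral>x. pay \<gamma> h y x (ltime x) \<partial>S)"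

definition mean_ltime :: real where
  "mean_ltime = (\<integral>x. real (ltime x) \<partial>S)"

lemma ltime_ge_1: "ladder x \<noteq> \<infinity> \<Longrightarrow> ltime x \<ge> 1"
  using ladder_ge_1[of x] by (cases "ladder x") (auto simp: one_enat_def)

lemma mean_ltime_ge_1: "mean_ltime \<ge> 1"
proof -
  have "(\<integral>x. 1 \<partial>S) \<le> mean_ltime"
    unfolding mean_ltime_def
  proof (rule integral_mono_AE)
    show "AE x in S. 1 \<le> real (ltime x)"
      using AE_ladder_finite by eventually_elim (use ltime_ge_1 in force)
  qed (simp_all add: integrable_ltime)
  then show ?thesis using P.prob_space by simp
qed

lemma integrable_pay_ltime: "integrable S (\<lambda>x. pay \<gamma> h y x (ltime x))"
  unfolding pay_def using integrable_reward integrable_lcost by simp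

lemma entry_comb_finite:
  assumes "\<And>i. i < s \<Longrightarrow> z + psum x i \<notin> U" "entry U (z + psum x s) x' \<noteq> \<infinity>"
  shows "entry U z (comb_seq s x x') = enat (s + etime U (z + psum x s) x')"
  using entry_comb[of s z x U x'] assms by auto

text \<open>Holds path by path: over a positive ladder height a concave function gains less from the
  higher start, and the monotone cost is larger there. The difference is \<open>f\<close> times
  \<open>mean_ltime\<close>.\<close>

lemma phi_diff_antimono_of_concave:
  assumes concave: "concave_on {xbar..} \<gamma>" and le: "xbar \<le> z" "z \<le> y"
  shows "phi y - \<gamma> y \<le> phi z - \<gamma> z"
proof -
  have "(\<integral>x. pay \<gamma> h y x (ltime x) - \<gamma> y \<partial>S) \<le> (\<integral>x. pay \<gamma> h z x (ltime x) - \<gamma> z \<partial>S)"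
  proof (rule integral_mono_AE)
    show "AE x in S. pay \<gamma> h y x (ltime x) - \<gamma> y \<le> pay \<gamma> h z x (ltime x) - \<gamma> z"
      using AE_ladder_height_pos
    proof eventually_elim
      case (elim x)
      then show ?case
        using concave_on_increment_antimono[OF concave le, of "ladder_height x"]
          cost_mono_start[OF mono_h le(2), of x "ltime x"] by (simp add: pay_def)
    qed
  qed (use integrable_pay_ltime in simp_all)
  then show ?thesis
    using integrable_pay_ltime P.prob_space by (simp add: phi_def)
qed

text \<open>
  Iteration over the ladder times. The deficit \<open>\<gamma> y - R y\<close> is contracted by the factor \<open>theta\<close> in each iteration.
\<close>

lemma gamma_le_entry_pay:
  assumes U: "upper_ray U" and c: "c \<ge> 0" and z: "z \<notin> U"
    and step: "\<And>y. z \<le> y \<Longrightarrow> y \<notin> U \<Longrightarrow> \<gamma> y \<le> phi y + c * mean_ltime"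
  shows "\<gamma> z \<le> (\<integral>x. pay \<gamma> h z x (etime U z x) + c * real (etime U z x) \<partial>S)"
proof -
  define g where "g y x = pay \<gamma> h y x (etime U y x) + c * real (etime U y x)" for y x
  define R where "R y = (\<integral>x. g y x \<partial>S)" for y
  have [measurable]: "U \<in> sets borel"
    using U by (rule upper_ray_sets)
  have gI: "integrable S (g y)" for y
    unfolding g_def[abs_def] using integrable_pay_etime[OF U] integrable_etime[OF U] by simp
  have R_in: "R y = \<gamma> y" if "y \<in> U" for y
    unfolding R_def g_def using that P.prob_space by (simp add: entry_in_0)
  obtain K where K: "K \<ge> 0" "\<And>y. y \<notin> U \<Longrightarrow> (\<integral>x. cost h y x (etime U y x) \<partial>S) \<le> K * exp (- y)"
    using cost_etime_le[OF U] by blast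
  \<comment> \<open>Ladder steps only lead upward, so the induction stays among the points above
    \<open>z\<close>, where \<open>step\<close> applies.\<close>
  have "\<gamma> y - R y \<le> K * theta ^ n * exp (- y)" if "z \<le> y" "y \<notin> U" for y n
    using that
  proof (induction n arbitrary: y)
    case 0
    \<comment> \<open>The ray is entered at or above \<open>y\<close>, so the reward does not fall
      and the initial deficit is at most the mean entry cost.\<close>
    have "(\<integral>x. \<gamma> y - cost h y x (etime U y x) \<partial>S) \<le> R y"
      unfolding R_def
    proof (rule integral_mono_AE)
      show "AE x in S. \<gamma> y - cost h y x (etime U y x) \<le> g y x"
        using AE_entry_finite[OF U, of y]
      proof eventually_elim
        case (elim x)
        have "y \<le> y + psum x (etime U y x)"
          using upper_rayD[OF U etime_in[OF elim], of y] 0 by linarith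
        then have "\<gamma> y \<le> \<gamma> (y + psum x (etime U y x))"
          by (rule monoD[OF mono_gamma])
        then show ?case using c by (simp add: g_def pay_def add_increasing2)
      qed
    qed (use gI integrable_cost_etime[OF U] in simp_all)
    then show ?case
      using K(2)[of y] 0 integrable_cost_etime[OF U, of y] P.prob_space by simp
  next
    case (Suc n)
    \<comment> \<open>\<open>A\<close> is what accrues up to the ladder time, bonus minus cost; from
      there the walk starts afresh at the ladder position.\<close>
    define A where "A x = c * real (ltime x) - cost h y x (ltime x)" for x
    define G where "G x x' = A x + g (y + ladder_height x) x'" for x x'
    have AI: "integrable S A"
      unfolding A_def[abs_def] using integrable_ltime integrable_lcost by simp
    have G_meas: "(\<lambda>p. G (fst p) (snd p)) \<in> borel_measurable (S \<Otimes>\<^sub>M S)"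
      unfolding G_def A_def g_def by measurable
    have FG: "AE x in S. AE x' in S. \<forall>n. ladder x = enat n \<longrightarrow> g y (comb_seq n x x') = G x x'"
    proof (rule AE_I2)
      fix x
      show "AE x' in S. \<forall>n. ladder x = enat n \<longrightarrow> g y (comb_seq n x x') = G x x'"
        using AE_entry_finite[OF U, of "y + ladder_height x"]
      proof eventually_elim
        case (elim x')
        show ?case
        proof (intro allI impI)
          fix n assume n: "ladder x = enat n"
          have "y + psum x i \<notin> U" if "i < n" for i
            using n that upper_ray_notin[OF U Suc.prems(2), of "y + psum x i"] by (auto simp: ladder_eq_enat)
          then have "entry U y (comb_seq n x x') = enat (n + etime U (y + psum x n) x')"
            using elim n by (intro entry_comb_finite) auto
          then show "g y (comb_seq n x x') = G x x'"
            using n by (simp add: g_def G_def A_def pay_comb_add algebra_simps)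
        qed
      qed
    qed
    have inner: "(\<integral>x'. G x x' \<partial>S) = A x + R (y + ladder_height x)" for x
      unfolding G_def R_def using gI P.prob_space by simp
    note mk = integral_markov[OF stopping_ladder AE_ladder_finite gI G_meas FG]
    have AR: "integrable S (\<lambda>x. A x + R (y + ladder_height x))" "R y = (\<integral>x. A x + R (y + ladder_height x) \<partial>S)"
      using mk inner by (simp_all add: R_def)
    have RI: "integrable S (\<lambda>x. R (y + ladder_height x))"
      using Bochner_Integration.integrable_diff[OF AR(1) AI] by simp
    have "\<gamma> y \<le> phi y + c * mean_ltime"
      using step Suc.prems by simp
    also have "\<dots> = (\<integral>x. \<gamma> (y + ladder_height x) \<partial>S) + (\<integral>x. A x \<partial>S)"
      unfolding phi_def mean_ltime_def pay_def A_def
      using integrable_reward integrable_lcost integrable_ltime by simp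
    finally have "\<gamma> y - R y \<le> (\<integral>x. \<gamma> (y + ladder_height x) - R (y + ladder_height x) \<partial>S)"
      using AR(2) AI RI integrable_reward by simp
    also have "\<dots> \<le> (\<integral>x. K * theta ^ n * exp (- y) * exp (- ladder_height x) \<partial>S)"
    proof (rule integral_mono_AE)
      show "AE x in S. \<gamma> (y + ladder_height x) - R (y + ladder_height x) \<le> K * theta ^ n * exp (- y) * exp (- ladder_height x)"
        using AE_ladder_height_pos
      proof eventually_elim
        case (elim x)
        show ?case
        proof (cases "y + ladder_height x \<in> U")
          case True
          then show ?thesis using K(1) theta_nonneg by (simp add: R_in)
        next
          case False
          have "exp (- (y + ladder_height x)) = exp (- y) * exp (- ladder_height x)"
            by (simp flip: exp_add)
          then show ?thesis
            using Suc.IH[of "y + ladder_height x"] elim Suc.prems False by (simp add: mult.assoc)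
        qed
      qed
    qed (use RI integrable_reward integrable_exp_height in simp_all)
    also have "\<dots> = K * theta ^ Suc n * exp (- y)"
      by (simp add: theta_def[symmetric])
    finally show ?case .
  qed
  then have "\<gamma> z - R z \<le> K * theta ^ n * exp (- z)" for n
    using z by simp
  moreover have "(\<lambda>n. K * theta ^ n * exp (- z)) \<longlonglongrightarrow> K * 0 * exp (- z)"
    by (intro tendsto_intros LIMSEQ_power_zero) (use theta_nonneg theta_less_1 in simp)
  ultimately have "\<gamma> z - R z \<le> K * 0 * exp (- z)"
    by (intro LIMSEQ_le_const) blast+
  then show ?thesis by (simp add: R_def g_def)
qed

end

text \<open>\<open>B_ge\<close> and \<open>B_gt\<close> leave only the closed and the open ray at
  \<open>xbar\<close>. Since \<open>phi - \<gamma>\<close> is \<open>f\<close> times the mean ladder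
  time, \<open>below\<close> and \<open>above\<close> prescribe the sign of \<open>f\<close> off and
  on \<open>B\<close>.\<close>

locale threshold_problem = walk_problem +
  fixes xbar :: real and B :: "real set"
  assumes concave: "concave_on {xbar..} \<gamma>"
    and B_ray: "upper_ray B" and B_ge: "z \<in> B \<Longrightarrow> xbar \<le> z" and B_gt: "xbar < z \<Longrightarrow> z \<in> B"
    and below: "z \<notin> B \<Longrightarrow> \<gamma> z \<le> phi z" and above: "z \<in> B \<Longrightarrow> phi z \<le> \<gamma> z"
begin

lemma B_sets [measurable]: "B \<in> sets borel"
  using B_ray by (rule upper_ray_sets)

lemma gamma_le_pay_entry_B:
  assumes "z \<notin> B"
  shows "\<gamma> z \<le> (\<integral>x. pay \<gamma> h z x (etime B z x) \<partial>S)"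
  using gamma_le_entry_pay[OF B_ray, of 0 z] assms below by simp

text \<open>The bound mentions only the later time \<open>t\<close>, so it dominates the pay-offs at
  all such \<open>s\<close> at once. It is used with the ladder time and with the first passage
  above a level as \<open>t\<close>.\<close>

lemma abs_pay_le:
  assumes "y + psum x s \<in> B" "s \<le> t" "psum x s \<le> psum x t"
  shows "\<bar>pay \<gamma> h y x s\<bar> \<le> \<bar>\<gamma> xbar\<bar> + \<bar>\<gamma> (y + psum x t)\<bar> + cost h y x t"
proof -
  have "\<gamma> xbar \<le> \<gamma> (y + psum x s)" "\<gamma> (y + psum x s) \<le> \<gamma> (y + psum x t)"
    using assms B_ge[OF assms(1)] by (auto intro: monoD[OF mono_gamma])
  moreover have "0 \<le> cost h y x s" "cost h y x s \<le> cost h y x t"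
    using h_cost_nonneg cost_mono_time[of h s t] h_nonneg assms by auto
  ultimately show ?thesis by (simp add: pay_def)
qed

text \<open>The ladder position lies above \<open>y\<close> and hence in \<open>B\<close>, so the
  return has happened by then. Before the ladder time the walk is at or below \<open>y\<close>, so a
  return cannot be higher than the ladder position.\<close>

lemma return_le_ladder:
  assumes y: "y \<in> B" and n: "ladder x = enat n"
  obtains s where "entry_from 1 B y x = enat s" "1 \<le> s" "s \<le> n" "y + psum x s \<in> B" "psum x s \<le> psum x n"
    "\<And>i. 1 \<le> i \<Longrightarrow> i < s \<Longrightarrow> y + psum x i \<notin> B"
proof -
  have n1: "n \<ge> 1" using ladder_ge_1[of x] n by (simp add: one_enat_def)
  have pos: "psum x n > 0" and neg: "\<And>m. m < n \<Longrightarrow> psum x m \<le> 0"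
    using n by (auto simp: ladder_eq_enat)
  have "y + psum x n \<in> B"
    using upper_rayD[OF B_ray y] pos by simp
  then have "entry_from 1 B y x \<le> enat n"
    using n1 by (auto simp: entry_from_le_iff one_enat_def)
  then obtain s where s: "entry_from 1 B y x = enat s" "s \<le> n"
    by (metis enat_ile enat_ord_simps(1))
  have s': "1 \<le> s" "y + psum x s \<in> B" "\<forall>i<s. 1 \<le> i \<longrightarrow> y + psum x i \<notin> B"
    using s(1) by (auto simp: entry_from_eq_enat one_enat_def)
  have "psum x s \<le> psum x n"
    using neg[of s] pos s(2) by (cases "s = n") auto
  then show ?thesis using that s s' by blast
qed

abbreviation rtime :: "real \<Rightarrow> (nat \<Rightarrow> real) \<Rightarrow> nat" where
  "rtime y x \<equiv> the_enat (entry_from 1 B y x)"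

lemma integrable_pay_return:
  assumes y: "y \<in> B"
  shows "integrable S (\<lambda>x. pay \<gamma> h y x (rtime y x))" "integrable S (\<lambda>x. real (rtime y x))"
proof -
  have "integrable S (\<lambda>x. \<bar>\<gamma> xbar\<bar> + \<bar>\<gamma> (y + ladder_height x)\<bar> + cost h y x (ltime x))"
    using integrable_reward integrable_lcost by simp
  then show "integrable S (\<lambda>x. pay \<gamma> h y x (rtime y x))"
  proof (rule Bochner_Integration.integrable_bound)
    show "AE x in S. norm (pay \<gamma> h y x (rtime y x))
        \<le> norm (\<bar>\<gamma> xbar\<bar> + \<bar>\<gamma> (y + ladder_height x)\<bar> + cost h y x (ltime x))"
      using AE_ladder_finite
    proof eventually_elim
      case (elim x)
      then obtain n where n: "ladder x = enat n" by auto
      obtain s where s: "entry_from 1 B y x = enat s" "s \<le> n" "y + psum x s \<in> B" "psum x s \<le> psum x n"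
        using return_le_ladder[OF y n] by metis
      show ?case
        using abs_pay_le[OF s(3,2,4)] s(1) n by simp
    qed
  qed measurable
  show "integrable S (\<lambda>x. real (rtime y x))"
  proof (rule Bochner_Integration.integrable_bound[OF integrable_ltime])
    show "AE x in S. norm (real (rtime y x)) \<le> norm (real (ltime x))"
      using AE_ladder_finite
    proof eventually_elim
      case (elim x)
      then obtain n where n: "ladder x = enat n" by auto
      obtain s where s: "entry_from 1 B y x = enat s" "s \<le> n"
        using return_le_ladder[OF y n] by metis
      then show ?case using n by simp
    qed
  qed measurable
qed

text \<open>
  With \<open>c = (\<gamma> y - phi y) / mean_ltime\<close>
  added to the reward rate, waiting for the ladder time is neutral at \<open>y\<close> and, by concavity,
  favourable at all points of \<open>B\<close> up to \<open>y\<close>; hence the return time is worth at most the ladder time.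
\<close>

lemma pay_return_le:
  assumes y: "y \<in> B"
  shows "(\<integral>x. pay \<gamma> h y x (rtime y x) \<partial>S) \<le> \<gamma> y"
proof -
  define U where "U = {y<..}"
  define c where "c = (\<gamma> y - phi y) / mean_ltime"
  have U: "upper_ray U" by (simp add: U_def)
  have UB: "U \<subseteq> B" using upper_rayD[OF B_ray y] by (auto simp: U_def)
  \<comment> \<open>As the entry into the fixed ray \<open>U\<close>, the ladder time can be
    restarted: from the return position the walk has to enter the same ray.\<close>
  have lad: "entry U y = ladder" by (auto simp: U_def entry_greaterThan_self)
  have c: "c \<ge> 0" using above[OF y] mean_ltime_ge_1 by (simp add: c_def)
  have cm: "c * mean_ltime = \<gamma> y - phi y" using mean_ltime_ge_1 by (simp add: c_def)
  define F1 where "F1 x = pay \<gamma> h y x (ltime x) + c * real (ltime x)" for x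
  define F2 where "F2 x = pay \<gamma> h y x (rtime y x) + c * real (rtime y x)" for x
  define g where "g z x' = pay \<gamma> h z x' (etime U z x') + c * real (etime U z x')" for z x'
  \<comment> \<open>Advantage, with bonus \<open>c\<close> per step, of going on from the return
    position to the ladder time over stopping there.\<close>
  define G where "G x x' = g (y + psum x (rtime y x)) x' - \<gamma> (y + psum x (rtime y x))" for x x'
  have I1: "integrable S F1"
    unfolding F1_def[abs_def] using integrable_pay_ltime integrable_ltime by simp
  have I2: "integrable S F2"
    unfolding F2_def[abs_def] using integrable_pay_return[OF y] by simp
  have E1: "(\<integral>x. F1 x \<partial>S) = \<gamma> y"
    unfolding F1_def using integrable_pay_ltime[of y] integrable_ltime cm
    by (simp add: phi_def[symmetric] mean_ltime_def[symmetric])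
  have [measurable]: "U \<in> sets borel" by (simp add: U_def)
  have fin: "AE x in S. entry_from 1 B y x \<noteq> \<infinity>"
    using AE_ladder_finite
  proof eventually_elim
    case (elim x)
    then obtain n where n: "ladder x = enat n" by auto
    show ?case using return_le_ladder[OF y n] by (metis enat.distinct(2))
  qed
  have G_meas: "(\<lambda>p. G (fst p) (snd p)) \<in> borel_measurable (S \<Otimes>\<^sub>M S)"
    unfolding G_def g_def by measurable
  have FG: "AE x in S. AE x' in S. \<forall>s. entry_from 1 B y x = enat s \<longrightarrow>
      F1 (comb_seq s x x') - F2 (comb_seq s x x') = G x x'"
  proof (rule AE_I2)
    fix x
    show "AE x' in S. \<forall>s. entry_from 1 B y x = enat s \<longrightarrow>
      F1 (comb_seq s x x') - F2 (comb_seq s x x') = G x x'"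
      using AE_entry_finite[OF U, of "y + psum x (rtime y x)"]
    proof eventually_elim
      case (elim x')
      show ?case
      proof (intro allI impI)
        fix s assume s: "entry_from 1 B y x = enat s"
        have "y + psum x i \<notin> U" if "i < s" for i
        proof (cases "i = 0")
          case True
          then show ?thesis by (simp add: U_def)
        next
          case False
          then have "y + psum x i \<notin> B" using s that by (auto simp: entry_from_eq_enat one_enat_def)
          then show ?thesis using UB by blast
        qed
        then have "entry U y (comb_seq s x x') = enat (s + etime U (y + psum x s) x')"
          using elim s by (intro entry_comb_finite) auto
        then have l: "ltime (comb_seq s x x') = s + etime U (y + psum x s) x'"
          by (simp add: lad)
        have "entry_from 1 B y (comb_seq s x x') = enat s"
          using stopping_comb[OF stopping_entry_from[OF B_sets] s] .
        then have "F2 (comb_seq s x x') = pay \<gamma> h y x s + c * real s"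
          by (simp add: F2_def pay_comb_le)
        moreover have "F1 (comb_seq s x x') = g (y + psum x s) x' - cost h y x s + c * real s"
          unfolding F1_def l g_def pay_comb_add by (simp add: algebra_simps)
        ultimately show "F1 (comb_seq s x x') - F2 (comb_seq s x x') = G x x'"
          by (simp add: G_def s pay_def)
      qed
    qed
  qed
  have gI: "integrable S (g z)" for z
    unfolding g_def[abs_def] using integrable_pay_etime[OF U] integrable_etime[OF U] by simp
  have pos: "AE x in S. 0 \<le> (\<integral>x'. G x x' \<partial>S)"
    using fin
  proof eventually_elim
    case (elim x)
    define z where "z = y + psum x (rtime y x)"
    obtain s where "entry_from 1 B y x = enat s" using elim by auto
    then have zB: "z \<in> B" using entry_from_eq_enat[of 1 B y x s] by (simp add: z_def)
    have "(\<integral>x'. G x x' \<partial>S) = (\<integral>x'. g z x' \<partial>S) - \<gamma> z"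
      unfolding G_def z_def[symmetric] using gI P.prob_space by simp
    also have "\<dots> \<ge> 0"
    proof (cases "z \<in> U")
      case True
      then show ?thesis using P.prob_space by (simp add: g_def entry_in_0)
    next
      case False
      \<comment> \<open>Between \<open>z\<close> and \<open>y\<close> the difference
        \<open>phi u - \<gamma> u\<close> is at least its value at \<open>y\<close>, which is
        \<open>- c * mean_ltime\<close>.\<close>
      have "\<gamma> u \<le> phi u + c * mean_ltime" if "z \<le> u" "u \<notin> U" for u
        using phi_diff_antimono_of_concave[OF concave, of u y] B_ge[OF zB] that cm by (simp add: U_def)
      then show ?thesis
        using gamma_le_entry_pay[OF U c False] by (simp add: g_def)
    qed
    finally show ?case .
  qed
  have "0 \<le> (\<integral>x. \<integral>x'. G x x' \<partial>S \<partial>S)"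
    using pos by (rule integral_nonneg_AE)
  also have "\<dots> = (\<integral>x. F1 x - F2 x \<partial>S)"
    using integral_markov(2)[OF stopping_entry_from[OF B_sets] fin Bochner_Integration.integrable_diff[OF I1 I2] G_meas FG] by simp
  also have "\<dots> = \<gamma> y - (\<integral>x. F2 x \<partial>S)"
    using I1 I2 E1 by simp
  finally have "(\<integral>x. F2 x \<partial>S) \<le> \<gamma> y" by simp
  moreover have "(\<integral>x. pay \<gamma> h y x (rtime y x) \<partial>S) \<le> (\<integral>x. F2 x \<partial>S)"
    using integrable_pay_return[OF y] I2 c by (intro integral_mono) (auto simp: F2_def)
  ultimately show ?thesis by simp
qed

end

subsection \<open>Arbitrary stopping times\<close>

context threshold_problem
begin

abbreviation aft :: "real \<Rightarrow> enat \<Rightarrow> (nat \<Rightarrow> real) \<Rightarrow> nat" where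
  "aft y r x \<equiv> the_enat (entry_from r B y x)"

text \<open>The first passage above \<open>a\<close> plays the role of the ladder time in
  \<open>return_le_ladder\<close>: before it the walk is at most \<open>a\<close>, and at it the
  walk is above \<open>xbar\<close>, hence in \<open>B\<close>.\<close>

lemma aft_bound:
  assumes a: "xbar \<le> a" and n: "entry {a<..} y x = enat n" and r: "r \<le> enat n"
  obtains s where "entry_from r B y x = enat s" "s \<le> n" "y + psum x s \<in> B" "psum x s \<le> psum x n"
proof -
  have n': "a < y + psum x n" "\<And>m. m < n \<Longrightarrow> y + psum x m \<le> a"
    using n by (auto simp: entry_eq_enat not_less)
  then have "y + psum x n \<in> B" using a B_gt by auto
  then have "entry_from r B y x \<le> enat n"
    using r by (auto simp: entry_from_le_iff)
  then obtain s where s: "entry_from r B y x = enat s" "s \<le> n"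
    by (metis enat_ile enat_ord_simps(1))
  have "psum x s \<le> psum x n"
    using n'(1) n'(2)[of s] s(2) by (cases "s = n") auto
  moreover have "y + psum x s \<in> B"
    using s(1) by (simp add: entry_from_eq_enat)
  ultimately show ?thesis using that s by blast
qed

text \<open>
  Postponing \<open>\<rho>\<close> to the next time in \<open>B\<close> gains by \<open>gamma_le_pay_entry_B\<close>. With \<open>min \<rho> n\<close>
  in place of \<open>\<rho>\<close>, the mean pay-off decreases in \<open>n\<close> by \<open>pay_return_le\<close>: the two postponed
  times differ only if the walk is in \<open>B\<close> at time \<open>n\<close>, and then by one return to \<open>B\<close>. For
  \<open>n = 0\<close> one gets the threshold rule. The first passage above \<open>a\<close> supplies the integrable bound.
\<close>

lemma pay_bounded_stop_le:
  assumes a: "xbar \<le> a" and \<rho>: "stopping \<rho>" and le: "\<And>x. \<rho> x \<le> entry {a<..} y x"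
    and I: "integrable S (\<lambda>x. pay \<gamma> h y x (the_enat (\<rho> x)))"
  shows "(\<integral>x. pay \<gamma> h y x (the_enat (\<rho> x)) \<partial>S) \<le> (\<integral>x. pay \<gamma> h y x (etime B y x) \<partial>S)"
proof -
  have [measurable]: "\<rho> \<in> measurable S (count_space UNIV)"
    using \<rho> by (rule stopping_measurable)
  define T where "T = etime {a<..} y"
  define Z where "Z x = \<bar>\<gamma> xbar\<bar> + \<bar>\<gamma> (y + psum x (T x))\<bar> + cost h y x (T x)" for x
  have ZI: "integrable S Z"
    unfolding Z_def[abs_def] T_def using integrable_gamma_etime[of "{a<..}" y] integrable_cost_etime[of "{a<..}" y]
    by simp
  have Tfin: "AE x in S. entry {a<..} y x \<noteq> \<infinity>"
    by (rule AE_entry_finite) simp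
  \<comment> \<open>A single integrable bound for every admissible \<open>r\<close>; it dominates
    all \<open>W n\<close> and the limit \<open>W'\<close>.\<close>
  have dom: "\<bar>pay \<gamma> h y x (aft y r x)\<bar> \<le> Z x" if e: "entry {a<..} y x \<noteq> \<infinity>" and re: "r \<le> entry {a<..} y x" for x r
  proof -
    obtain n where n: "entry {a<..} y x = enat n" using e by auto
    have rn: "r \<le> enat n" using re n by simp
    obtain s where s: "entry_from r B y x = enat s" "s \<le> n" "y + psum x s \<in> B" "psum x s \<le> psum x n"
      using aft_bound[OF a n rn] by blast
    show ?thesis
      using abs_pay_le[OF s(3,2,4)] s(1) n by (simp add: Z_def T_def)
  qed
  define r where "r n x = min (\<rho> x) (enat n)" for n x
  have r_stop: "stopping (r n)" for n
    unfolding r_def[abs_def] by (intro stopping_min \<rho> stopping_const)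
  have [measurable]: "r n \<in> measurable S (count_space UNIV)" for n
    using r_stop by (rule stopping_measurable)
  have r_le: "r n x \<le> entry {a<..} y x" for n x
    unfolding r_def using le[of x] by (simp add: min.coboundedI1)
  define W where "W n x = pay \<gamma> h y x (aft y (r n x) x)" for n x
  define W' where "W' x = pay \<gamma> h y x (aft y (\<rho> x) x)" for x
  have W_meas [measurable]: "W n \<in> borel_measurable S" "W' \<in> borel_measurable S" for n
    unfolding W_def W'_def by measurable
  have W_dom: "AE x in S. norm (W n x) \<le> Z x" for n
    using Tfin by eventually_elim (simp add: W_def dom r_le)
  have W'_dom: "AE x in S. norm (W' x) \<le> Z x"
    using Tfin by eventually_elim (simp add: W'_def dom le)
  have WI: "integrable S (W n)" for n
    by (rule Bochner_Integration.integrable_bound[OF ZI]) (use W_dom[of n] in \<open>auto elim!: eventually_mono\<close>)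
  have W'I: "integrable S W'"
    by (rule Bochner_Integration.integrable_bound[OF ZI]) (use W'_dom in \<open>auto elim!: eventually_mono\<close>)
  have step: "(\<integral>x. W (Suc n) x \<partial>S) \<le> (\<integral>x. W n x \<partial>S)" for n
  proof -
    define G where "G x x' = (if enat n < \<rho> x \<and> y + psum x n \<in> B
      then pay \<gamma> h (y + psum x n) x' (rtime (y + psum x n) x') - \<gamma> (y + psum x n) else 0)" for x x'
    have DI: "integrable S (\<lambda>x. W (Suc n) x - W n x)"
      using WI by simp
    have G_meas: "(\<lambda>p. G (fst p) (snd p)) \<in> borel_measurable (S \<Otimes>\<^sub>M S)"
      unfolding G_def by measurable
    have fin: "AE x in S. enat n \<noteq> \<infinity>" by simp
    have FG: "AE x in S. AE x' in S. \<forall>m. enat n = enat m \<longrightarrow>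
        W (Suc n) (comb_seq m x x') - W n (comb_seq m x x') = G x x'"
    proof (rule AE_I2)
      fix x
      show "AE x' in S. \<forall>m. enat n = enat m \<longrightarrow>
        W (Suc n) (comb_seq m x x') - W n (comb_seq m x x') = G x x'"
        using AE_ladder_finite
      proof eventually_elim
        case (elim x')
        define w where "w = comb_seq n x x'"
        define z where "z = y + psum x n"
        have w_psum: "y + psum w n = z" by (simp add: w_def z_def psum_comb_le)
        have agree: "\<And>i. i < n \<Longrightarrow> w i = x i" by (simp add: w_def comb_seq_def)
        \<comment> \<open>Whether \<open>\<rho>\<close> exceeds \<open>n\<close> is decided by the
          first \<open>n\<close> steps, which \<open>w\<close> and \<open>x\<close> share.\<close>
        have lt: "enat n < \<rho> w \<longleftrightarrow> enat n < \<rho> x"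
        proof -
          have "\<rho> u \<le> enat n" if v: "\<rho> v \<le> enat n" and vu: "\<And>i. i < n \<Longrightarrow> v i = u i" for u v
          proof -
            obtain m where m: "\<rho> v = enat m" "m \<le> n"
              using v by (metis enat_ile enat_ord_simps(1))
            then have "\<rho> u = enat m" using stoppingD[OF \<rho> m(1), of u] vu by simp
            then show ?thesis using m(2) by simp
          qed
          then show ?thesis using agree by (metis not_le)
        qed
        have "W (Suc n) w - W n w = G x x'"
        proof (cases "enat n < \<rho> x")
          case False
          then have "\<rho> w \<le> enat n" using lt by simp
          moreover then have "\<rho> w \<le> enat (Suc n)" by (meson enat_ord_simps(1) le_SucI order.trans order_refl)
          ultimately show ?thesis using False by (simp add: W_def r_def G_def min_absorb1)
        next
          case True
          then have "enat n < \<rho> w" using lt by simp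
          then have rn: "r n w = enat n" "r (Suc n) w = enat (Suc n)"
            by (simp_all add: r_def min_absorb2 Suc_ile_eq)
          show ?thesis
          proof (cases "z \<in> B")
            case False
            \<comment> \<open>Outside \<open>B\<close> at time \<open>n\<close>, waiting for
              \<open>B\<close> from time \<open>n\<close> or from time \<open>Suc n\<close> is the
              same.\<close>
            have "(enat (Suc n) \<le> enat k \<and> y + psum w k \<in> B) \<longleftrightarrow> (enat n \<le> enat k \<and> y + psum w k \<in> B)" for k
              using False w_psum by (cases "k = n") auto
            then have "entry_from (enat (Suc n)) B y w = entry_from (enat n) B y w"
              by (simp add: entry_from_def)
            then show ?thesis using False rn by (simp add: W_def G_def z_def)
          next
            case inB: True
            have e0: "entry_from (enat n) B y w = enat n"
              using inB w_psum by (simp add: entry_from_eq_enat)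
            obtain k where k: "ladder x' = enat k" using elim by auto
            obtain s where s: "entry_from 1 B z x' = enat s"
              using return_le_ladder[OF inB k] by metis
            have e1: "entry_from (enat (Suc n)) B y w = enat (n + s)"
              using entry_from_comb[of n "Suc n" y x B x'] s by (simp add: w_def z_def one_enat_def)
            show ?thesis
              using rn e0 e1 inB True s unfolding W_def G_def z_def[symmetric]
              by (simp add: w_def pay_comb_add pay_comb_le z_def) (simp add: pay_def)
          qed
        qed
        then show ?case by (simp add: w_def)
      qed
    qed
    have "(\<integral>x. W (Suc n) x - W n x \<partial>S) = (\<integral>x. \<integral>x'. G x x' \<partial>S \<partial>S)"
      by (rule integral_markov(2)[OF stopping_const fin DI G_meas FG])
    also have "\<dots> \<le> (\<integral>x. 0 \<partial>S)"
    proof (rule integral_mono_AE', simp, rule AE_I2)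
      fix x
      show "(\<integral>x'. G x x' \<partial>S) \<le> 0"
      proof (cases "enat n < \<rho> x \<and> y + psum x n \<in> B")
        case True
        then show ?thesis
          using pay_return_le[of "y + psum x n"] integrable_pay_return(1)[of "y + psum x n"] P.prob_space
          by (simp add: G_def)
      next
        case False
        then have "G x x' = 0" for x' by (auto simp: G_def)
        then show ?thesis by simp
      qed
    qed simp
    finally show ?thesis using WI by simp
  qed
  have le0: "(\<integral>x. W n x \<partial>S) \<le> (\<integral>x. W 0 x \<partial>S)" for n
    by (induction n) (use step order_trans in blast)+
  have "(\<lambda>n. \<integral>x. W n x \<partial>S) \<longlonglongrightarrow> (\<integral>x. W' x \<partial>S)"
  proof (rule integral_dominated_convergence[OF _ _ ZI _ W_dom])
    show "AE x in S. (\<lambda>n. W n x) \<longlonglongrightarrow> W' x"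
      using Tfin
    proof eventually_elim
      case (elim x)
      then obtain m where "entry {a<..} y x = enat m" by auto
      then obtain k where k: "\<rho> x = enat k" using le[of x] by (metis enat_ile)
      \<comment> \<open>As \<open>\<rho>\<close> is finite here, \<open>min \<rho> n\<close>
        eventually equals \<open>\<rho>\<close>, so the convergence is eventual equality.\<close>
      have "\<forall>\<^sub>F n in sequentially. W n x = W' x"
        using eventually_ge_at_top[of k] by eventually_elim (simp add: W_def W'_def r_def k min_absorb1)
      then show ?case by (rule tendsto_eventually)
    qed
  qed measurable
  then have W'_le: "(\<integral>x. W' x \<partial>S) \<le> (\<integral>x. W 0 x \<partial>S)"
    using le0 by (intro LIMSEQ_le_const2) blast+
  have W0: "W 0 x = pay \<gamma> h y x (etime B y x)" for x
    by (simp add: W_def r_def flip: zero_enat_def)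
  have "(\<integral>x. pay \<gamma> h y x (the_enat (\<rho> x)) \<partial>S) \<le> (\<integral>x. W' x \<partial>S)"
  proof -
    \<comment> \<open>Advantage of waiting for \<open>B\<close> after \<open>\<rho>\<close>. Its
      mean over the continuation is zero if the walk is in \<open>B\<close> at \<open>\<rho>\<close>
      and non-negative otherwise.\<close>
    define G where "G x x' = pay \<gamma> h (y + psum x (the_enat (\<rho> x))) x' (etime B (y + psum x (the_enat (\<rho> x))) x')
      - \<gamma> (y + psum x (the_enat (\<rho> x)))" for x x'
    have DI: "integrable S (\<lambda>x. W' x - pay \<gamma> h y x (the_enat (\<rho> x)))"
      using W'I I by simp
    have G_meas: "(\<lambda>p. G (fst p) (snd p)) \<in> borel_measurable (S \<Otimes>\<^sub>M S)"
      unfolding G_def by measurable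
    have fin: "AE x in S. \<rho> x \<noteq> \<infinity>"
      using Tfin by eventually_elim (metis le enat_ord_simps(5))
    have FG: "AE x in S. AE x' in S. \<forall>s. \<rho> x = enat s \<longrightarrow>
        W' (comb_seq s x x') - pay \<gamma> h y (comb_seq s x x') (the_enat (\<rho> (comb_seq s x x'))) = G x x'"
    proof (rule AE_I2)
      fix x
      show "AE x' in S. \<forall>s. \<rho> x = enat s \<longrightarrow>
        W' (comb_seq s x x') - pay \<gamma> h y (comb_seq s x x') (the_enat (\<rho> (comb_seq s x x'))) = G x x'"
        using AE_entry_finite[OF B_ray, of "y + psum x (the_enat (\<rho> x))"]
      proof eventually_elim
        case (elim x')
        show ?case
        proof (intro allI impI)
          fix s assume s: "\<rho> x = enat s"
          obtain k where k: "entry B (y + psum x s) x' = enat k"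
            using elim s by auto
          have "entry_from (enat s) B y (comb_seq s x x') = enat (s + k)"
            using entry_from_comb[of s s y x B x'] k by (simp flip: zero_enat_def)
          then show "W' (comb_seq s x x') - pay \<gamma> h y (comb_seq s x x') (the_enat (\<rho> (comb_seq s x x'))) = G x x'"
            using s k stopping_comb[OF \<rho> s, of x']
            by (simp add: W'_def G_def pay_comb_add pay_comb_le) (simp add: pay_def)
        qed
      qed
    qed
    have "0 \<le> (\<integral>x. \<integral>x'. G x x' \<partial>S \<partial>S)"
    proof (rule Bochner_Integration.integral_nonneg)
      fix x
      define z where "z = y + psum x (the_enat (\<rho> x))"
      have "(\<integral>x'. G x x' \<partial>S) = (\<integral>x'. pay \<gamma> h z x' (etime B z x') \<partial>S) - \<gamma> z"
        unfolding G_def z_def[symmetric] using integrable_pay_etime[OF B_ray] P.prob_space by simp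
      also have "\<dots> \<ge> 0"
        using gamma_le_pay_entry_B[of z] P.prob_space by (cases "z \<in> B") (simp_all add: entry_in_0)
      finally show "0 \<le> (\<integral>x'. G x x' \<partial>S)" .
    qed
    also have "\<dots> = (\<integral>x. W' x - pay \<gamma> h y x (the_enat (\<rho> x)) \<partial>S)"
      by (rule integral_markov(2)[OF \<rho> fin DI G_meas FG, symmetric])
    finally show ?thesis using W'I I by simp
  qed
  then show ?thesis using W'_le by (simp add: W0)
qed

text \<open>
  By concavity, the gain that can still be made after reaching a point \<open>z \<ge> xbar\<close> is at most
  \<open>gain\<close>, which does not depend on \<open>z\<close>; this controls general stopping times past high levels.
\<close>

definition gain :: "(nat \<Rightarrow> real) \<Rightarrow> ennreal" where
  "gain x = (SUP n. ennreal (pay \<gamma> h xbar x n - \<gamma> xbar))"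

lemma gain_measurable [measurable]: "gain \<in> borel_measurable S"
  unfolding gain_def by measurable

lemma gain_finite: "(\<integral>\<^sup>+x. gain x \<partial>S) < \<infinity>"
proof -
  have "(\<integral>\<^sup>+x. gain x \<partial>S) \<le> (\<integral>\<^sup>+x. (SUP n. ennreal (pay \<gamma> h xbar x n)) + ennreal \<bar>\<gamma> xbar\<bar> \<partial>S)"
  proof (rule nn_integral_mono)
    fix x
    show "gain x \<le> (SUP n. ennreal (pay \<gamma> h xbar x n)) + ennreal \<bar>\<gamma> xbar\<bar>"
      unfolding gain_def
    proof (rule SUP_least)
      fix n
      have "ennreal (pay \<gamma> h xbar x n - \<gamma> xbar) \<le> ennreal (max 0 (pay \<gamma> h xbar x n) + \<bar>\<gamma> xbar\<bar>)"
        by (rule ennreal_leI) simp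
      also have "\<dots> = ennreal (pay \<gamma> h xbar x n) + ennreal \<bar>\<gamma> xbar\<bar>"
        by (simp add: ennreal_max_0)
      also have "\<dots> \<le> (SUP n. ennreal (pay \<gamma> h xbar x n)) + ennreal \<bar>\<gamma> xbar\<bar>"
        by (intro add_right_mono SUP_upper) simp
      finally show "ennreal (pay \<gamma> h xbar x n - \<gamma> xbar) \<le> (SUP n. ennreal (pay \<gamma> h xbar x n)) + ennreal \<bar>\<gamma> xbar\<bar>" .
    qed
  qed
  also have "\<dots> = (\<integral>\<^sup>+x. (SUP n. ennreal (pay \<gamma> h xbar x n)) \<partial>S) + ennreal \<bar>\<gamma> xbar\<bar>"
    by (subst nn_integral_add) (auto simp: P.emeasure_space_1[simplified])
  also have "\<dots> < \<infinity>"
    using sup_finite[of xbar] by (simp add: less_top)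
  finally show ?thesis .
qed

text \<open>If the walk has not risen, neither has the reward, and costs only reduce the pay-off. If
  it has risen, concavity and the monotone cost allow replacing \<open>z\<close> by
  \<open>xbar\<close>. The maximum with \<open>0\<close> is the truncation built into
  \<open>gain\<close>.\<close>

lemma pay_gain_le:
  assumes "xbar \<le> z" and fin: "gain x \<noteq> \<infinity>"
  shows "pay \<gamma> h z x n - \<gamma> z \<le> enn2real (gain x)"
proof -
  have "pay \<gamma> h z x n - \<gamma> z \<le> max 0 (pay \<gamma> h xbar x n - \<gamma> xbar)"
  proof (cases "psum x n \<le> 0")
    case True
    then have "\<gamma> (z + psum x n) \<le> \<gamma> z" by (intro monoD[OF mono_gamma]) simp
    then show ?thesis using h_cost_nonneg[of z x n] by (simp add: pay_def)
  next
    case False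
    then show ?thesis
      using concave_on_increment_antimono[OF concave _ assms(1), of "psum x n"]
        cost_mono_start[OF mono_h assms(1), of x n] by (simp add: pay_def)
  qed
  moreover have "ennreal (max 0 (pay \<gamma> h xbar x n - \<gamma> xbar)) \<le> gain x"
    unfolding gain_def by (auto simp: ennreal_max_0 intro: SUP_upper)
  then have "max 0 (pay \<gamma> h xbar x n - \<gamma> xbar) \<le> enn2real (gain x)"
    using fin by (metis enn2real_ennreal enn2real_mono infinity_ennreal_def less_top max.cobounded1)
  ultimately show ?thesis by linarith
qed

text \<open>Cut off at the first passage above \<open>a m\<close>, the time \<open>\<tau>\<close> is
  covered by \<open>pay_bounded_stop_le\<close>. By the strong Markov property at this passage, the
  cut costs at most \<open>w\<close> times the probability that \<open>\<tau>\<close> is still to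
  come, and this probability vanishes as \<open>m\<close> grows.\<close>

lemma pay_stop_le:
  assumes \<tau>: "stopping \<tau>" and fin: "AE x in S. \<tau> x \<noteq> \<infinity>"
    and I: "integrable S (\<lambda>x. pay \<gamma> h y x (the_enat (\<tau> x)))"
  shows "(\<integral>x. pay \<gamma> h y x (the_enat (\<tau> x)) \<partial>S) \<le> (\<integral>x. pay \<gamma> h y x (etime B y x) \<partial>S)"
    (is "_ \<le> ?V")
proof -
  interpret pair_sigma_finite S S ..
  have [measurable]: "\<tau> \<in> measurable S (count_space UNIV)"
    using \<tau> by (rule stopping_measurable)
  define g where "g x = pay \<gamma> h y x (the_enat (\<tau> x))" for x
  define w where "w = (\<integral>x. enn2real (gain x) \<partial>S)"
  \<comment> \<open>The level must be at least \<open>xbar\<close> for \<open>pay_gain_le\<close>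
    and must tend to infinity with \<open>m\<close>.\<close>
  define a where "a m = max 0 xbar + real m" for m :: nat
  define T where "T m = entry {a m<..} y" for m
  have a: "xbar \<le> a m" "real m \<le> a m" for m by (auto simp: a_def)
  have [measurable]: "T m \<in> measurable S (count_space UNIV)" for m
    unfolding T_def by measurable
  have T_stop: "stopping (T m)" for m
    unfolding T_def by (rule stopping_entry_from) simp
  have T_fin: "AE x in S. T m x \<noteq> \<infinity>" for m
    unfolding T_def by (rule AE_entry_finite) simp
  have gain_fin: "AE x in S. gain x \<noteq> \<infinity>"
    by (rule nn_integral_PInf_AE) (use gain_finite in auto)
  have gain_I: "integrable S (\<lambda>x. enn2real (gain x))"
  proof (rule integrableI_bounded)
    have "(\<integral>\<^sup>+x. ennreal (norm (enn2real (gain x))) \<partial>S) = (\<integral>\<^sup>+x. gain x \<partial>S)"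
      using gain_fin by (intro nn_integral_cong_AE) (auto elim!: eventually_mono simp: less_top)
    then show "(\<integral>\<^sup>+x. ennreal (norm (enn2real (gain x))) \<partial>S) < \<infinity>"
      using gain_finite by simp
  qed measurable
  \<comment> \<open>Finiteness of \<open>\<tau>\<close> depends on the continuation, so
    \<open>late\<close> cannot leave the inner integral; \<open>late'\<close> is decided by the path
    up to \<open>T m\<close> and can. The two agree almost surely, and \<open>late\<close> makes
    \<open>F\<close> vanish where \<open>\<tau>\<close> is infinite.\<close>
  define late :: "nat \<Rightarrow> (nat \<Rightarrow> real) \<Rightarrow> real" where
    "late m x = (if T m x < \<tau> x \<and> \<tau> x \<noteq> \<infinity> then 1 else 0)" for m x
  define late' :: "nat \<Rightarrow> (nat \<Rightarrow> real) \<Rightarrow> real" where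
    "late' m x = (if T m x < \<tau> x then 1 else 0)" for m x
  have lt_meas: "Measurable.pred S (\<lambda>x. T m x < \<tau> x)" for m
  proof (rule measurable_compose_countable[of "\<lambda>v x. v < \<tau> x"])
    show "Measurable.pred S (\<lambda>x. v < \<tau> x)" for v
      by (rule measurable_compose[OF stopping_measurable[OF \<tau>]]) simp
  qed measurable
  have fin_meas: "Measurable.pred S (\<lambda>x. \<tau> x \<noteq> \<infinity>)"
    by (rule measurable_compose[OF stopping_measurable[OF \<tau>]]) simp
  have sets: "{x \<in> space S. T m x < \<tau> x} \<in> sets S" "{x \<in> space S. T m x < \<tau> x \<and> \<tau> x \<noteq> \<infinity>} \<in> sets S" for m
    using lt_meas[of m] pred_intros_logic(3)[OF lt_meas[of m] fin_meas] unfolding Measurable.pred_def by blast+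
  have [measurable]: "late m \<in> borel_measurable S" for m
    unfolding late_def by (rule measurable_If[OF _ _ sets(2)]) simp_all
  have [measurable]: "late' m \<in> borel_measurable S" for m
    unfolding late'_def by (rule measurable_If[OF _ _ sets(1)]) simp_all
  have late_eq: "AE x in S. late m x = late' m x" for m
    using fin by eventually_elim (simp add: late_def late'_def)
  have main: "(\<integral>x. g x \<partial>S) \<le> ?V + w * (\<integral>x. late m x \<partial>S)" for m
  proof -
    define p where "p x = pay \<gamma> h y x (the_enat (T m x))" for x
    have p_I: "integrable S p"
      unfolding p_def[abs_def] T_def by (rule integrable_pay_etime) simp
    have g_I: "integrable S g"
      unfolding g_def[abs_def] by (rule I)
    \<comment> \<open>Extra pay-off of \<open>\<tau>\<close> over the passage time; subtracting it
      from \<open>g\<close> leaves, almost surely, the pay-off at the minimum of the two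
      times.\<close>
    define F where "F x = late m x * (g x - p x)" for x
    have [measurable]: "g \<in> borel_measurable S" "p \<in> borel_measurable S"
      using g_I p_I by auto
    have F_I: "integrable S F"
    proof (rule Bochner_Integration.integrable_bound[of S "\<lambda>x. g x - p x"])
      show "integrable S (\<lambda>x. g x - p x)" using g_I p_I by simp
      show "F \<in> borel_measurable S" unfolding F_def by measurable
      show "AE x in S. norm (F x) \<le> norm (g x - p x)" by (simp add: F_def late_def)
    qed
    have "AE x in S. AE x' in S. \<forall>n. T m x = enat n \<longrightarrow> F (comb_seq n x x') = F (comb_at (T m x) x x')"
      by simp
    moreover have [measurable]: "F \<in> borel_measurable S" using F_I by simp
    have "(\<lambda>q. F (comb_at (T m (fst q)) (fst q) (snd q))) \<in> borel_measurable (S \<Otimes>\<^sub>M S)"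
      by measurable
    ultimately have "(\<integral>x. F x \<partial>S) = (\<integral>x. \<integral>x'. F (comb_at (T m x) x x') \<partial>S \<partial>S)"
      using integral_markov(2)[OF T_stop[of m] T_fin[of m] F_I, where G = "\<lambda>x x'. F (comb_at (T m x) x x')"] by simp
    also have "\<dots> \<le> (\<integral>x. late' m x * w \<partial>S)"
    proof (rule integral_mono_AE')
      show "integrable S (\<lambda>x. late' m x * w)"
      proof (rule P.integrable_const_bound[of _ "\<bar>w\<bar>"])
        show "AE x in S. norm (late' m x * w) \<le> \<bar>w\<bar>" by (simp add: late'_def)
      qed measurable
      have w0: "w \<ge> 0" unfolding w_def by (rule Bochner_Integration.integral_nonneg) simp
      then show "AE x in S. 0 \<le> late' m x * w" by (simp add: late'_def)
      show "AE x in S. (\<integral>x'. F (comb_at (T m x) x x') \<partial>S) \<le> late' m x * w"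
        using T_fin[of m]
      proof eventually_elim
        case (elim x)
        then obtain n where n: "T m x = enat n" by auto
        have z: "xbar \<le> y + psum x n"
          using n a(1)[of m] by (auto simp: T_def entry_eq_enat)
        have "(\<integral>x'. F (comb_at (T m x) x x') \<partial>S) \<le> (\<integral>x'. late' m x * enn2real (gain x') \<partial>S)"
        proof (rule integral_mono_AE')
          show "integrable S (\<lambda>x'. late' m x * enn2real (gain x'))" using gain_I by simp
          show "AE x' in S. 0 \<le> late' m x * enn2real (gain x')" by (simp add: late'_def)
          show "AE x' in S. F (comb_at (T m x) x x') \<le> late' m x * enn2real (gain x')"
            using gain_fin
          proof eventually_elim
            case (elim x')
            define u where "u = comb_seq n x x'"
            have Tu: "T m u = enat n" unfolding u_def by (rule stopping_comb[OF T_stop n])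
            show ?case
            proof (cases "late m u = 0")
              case True
              then show ?thesis by (simp add: F_def n u_def late'_def)
            next
              case False
              then have lt: "enat n < \<tau> u" "\<tau> u \<noteq> \<infinity>" using Tu by (auto simp: late_def split: if_splits)
              then obtain k where k: "\<tau> u = enat k" "n < k" by auto
              define l where "l = k - n"
              have kl: "k = n + l" using k(2) by (simp add: l_def)
              have late'_x: "late' m x = 1"
              proof (rule ccontr)
                assume "late' m x \<noteq> 1"
                then have "\<tau> x \<le> enat n" using n by (auto simp: late'_def not_less split: if_splits)
                then obtain j where j: "\<tau> x = enat j" "j \<le> n" by (metis enat_ile enat_ord_simps(1))
                have "x i = u i" if "i < j" for i
                  using that j(2) by (simp add: u_def comb_seq_less)
                then have "\<tau> u = enat j"
                  by (rule stoppingD[OF \<tau> j(1)])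
                then show False using k j by simp
              qed
              have "F u = pay \<gamma> h (y + psum x n) x' l - \<gamma> (y + psum x n)"
                using lt Tu k unfolding F_def late_def g_def p_def kl
                by (simp add: u_def pay_comb_add pay_comb_le) (simp add: pay_def)
              also have "\<dots> \<le> enn2real (gain x')"
                by (rule pay_gain_le[OF z elim])
              finally show ?thesis using late'_x n by (simp add: u_def)
            qed
          qed
        qed
        then show ?case by (simp add: w_def)
      qed
    qed
    also have "\<dots> = w * (\<integral>x. late m x \<partial>S)"
    proof -
      have "(\<integral>x. late m x \<partial>S) = (\<integral>x. late' m x \<partial>S)"
        by (rule integral_cong_AE[OF _ _ late_eq]) measurable
      then show ?thesis by simp
    qed
    finally have F_le: "(\<integral>x. F x \<partial>S) \<le> w * (\<integral>x. late m x \<partial>S)" .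
    define \<rho> where "\<rho> x = min (\<tau> x) (T m x)" for x
    have \<rho>: "stopping \<rho>" unfolding \<rho>_def[abs_def] by (rule stopping_min[OF \<tau> T_stop])
    have [measurable]: "\<rho> \<in> measurable S (count_space UNIV)" using \<rho> by (rule stopping_measurable)
    have ae: "AE x in S. g x - F x = pay \<gamma> h y x (the_enat (\<rho> x))"
      using fin
    proof eventually_elim
      case (elim x)
      show ?case
      proof (cases "T m x < \<tau> x")
        case True
        then show ?thesis using elim by (simp add: F_def late_def p_def \<rho>_def min_absorb2)
      next
        case False
        then have "late m x = 0" by (simp add: late_def)
        then show ?thesis using False by (simp add: F_def g_def \<rho>_def min_absorb1 not_less)
      qed
    qed
    have gF_I: "integrable S (\<lambda>x. g x - F x)" using g_I F_I by simp
    have \<rho>_I: "integrable S (\<lambda>x. pay \<gamma> h y x (the_enat (\<rho> x)))"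
      using gF_I by (rule integrable_cong_AE_imp) (use ae in measurable)
    have "(\<integral>x. pay \<gamma> h y x (the_enat (\<rho> x)) \<partial>S) \<le> ?V"
      by (rule pay_bounded_stop_le[OF a(1)[of m] \<rho> _ \<rho>_I]) (simp add: \<rho>_def T_def)
    moreover have "(\<integral>x. g x - F x \<partial>S) = (\<integral>x. pay \<gamma> h y x (the_enat (\<rho> x)) \<partial>S)"
      by (rule integral_cong_AE[OF _ _ ae]) measurable
    ultimately show ?thesis using F_le g_I F_I by simp
  qed
  have "(\<lambda>m. \<integral>x. late m x \<partial>S) \<longlonglongrightarrow> (\<integral>x. 0 \<partial>S)"
  proof (rule integral_dominated_convergence[of _ _ _ "\<lambda>_. 1"])
    show "AE x in S. (\<lambda>m. late m x) \<longlonglongrightarrow> 0"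
      using fin
    proof eventually_elim
      case (elim x)
      then obtain n where n: "\<tau> x = enat n" by auto
      \<comment> \<open>Up to a finite \<open>\<tau>\<close> only finitely many positions are
        visited; once \<open>m\<close> reaches a bound for them, the path is not late.\<close>
      obtain M where M: "\<And>i. i \<le> n \<Longrightarrow> y + psum x i \<le> real M"
      proof -
        have "bdd_above ((\<lambda>i. y + psum x i) ` {..n})" by simp
        then obtain c where "\<And>i. i \<le> n \<Longrightarrow> y + psum x i \<le> c" by (auto simp: bdd_above_def)
        moreover obtain M where "c \<le> real M" using real_arch_simple by blast
        ultimately show ?thesis using that by (meson order_trans)
      qed
      have "\<forall>\<^sub>F m in sequentially. late m x = 0"
        using eventually_ge_at_top[of M]
      proof eventually_elim
        case (elim m)
        have "\<not> T m x \<le> enat n"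
        proof
          assume "T m x \<le> enat n"
          then obtain i where "i \<le> n" "a m < y + psum x i"
            by (auto simp: T_def entry_from_le_iff)
          then show False using M[of i] a(2)[of m] elim by simp
        qed
        then show ?case using n by (auto simp: late_def)
      qed
      then show ?case by (rule tendsto_eventually)
    qed
    show "AE x in S. norm (late m x) \<le> 1" for m by (simp add: late_def)
  qed simp_all
  then have "(\<lambda>m. ?V + w * (\<integral>x. late m x \<partial>S)) \<longlonglongrightarrow> ?V + w * 0"
    by (intro tendsto_intros) simp
  then have "(\<integral>x. g x \<partial>S) \<le> ?V + w * 0"
    using main by (intro LIMSEQ_le_const) blast+
  then show ?thesis by (simp add: g_def)
qed

end

subsection \<open>Transfer from path space\<close>

lemma ereal_expectation_integrable:
  assumes f: "integrable M f" and ae: "AE x in M. Z x = ereal (f x)"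
  shows "ereal_expectation M Z = ereal (\<integral>x. f x \<partial>M)"
proof -
  have "(\<integral>\<^sup>+x. e2ennreal (Z x) \<partial>M) = (\<integral>\<^sup>+x. ennreal (f x) \<partial>M)"
    using ae by (intro nn_integral_cong_AE) (auto elim!: eventually_mono)
  moreover have "(\<integral>\<^sup>+x. e2ennreal (- Z x) \<partial>M) = (\<integral>\<^sup>+x. ennreal (- f x) \<partial>M)"
    using ae by (intro nn_integral_cong_AE) (auto elim!: eventually_mono)
  moreover have "(\<integral>\<^sup>+x. ennreal (f x) \<partial>M) < \<infinity>" "(\<integral>\<^sup>+x. ennreal (- f x) \<partial>M) < \<infinity>"
    using f by (auto simp: real_integrable_def less_top)
  ultimately show ?thesis
    unfolding ereal_expectation_def real_lebesgue_integral_def[OF f]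
    by (cases "\<integral>\<^sup>+x. ennreal (f x) \<partial>M"; cases "\<integral>\<^sup>+x. ennreal (- f x) \<partial>M") auto
qed

context threshold_problem
begin

definition stopped :: "((nat \<Rightarrow> real) \<Rightarrow> enat) \<Rightarrow> real \<Rightarrow> (nat \<Rightarrow> real) \<Rightarrow> ereal" where
  "stopped \<tau> y x = (case \<tau> x of enat n \<Rightarrow> ereal (pay \<gamma> h y x n) | \<infinity> \<Rightarrow> - \<infinity>)"

lemma measurable_stopped:
  assumes "\<tau> \<in> measurable S (count_space UNIV)"
  shows "stopped \<tau> y \<in> borel_measurable S"
  unfolding stopped_def[abs_def]
proof (rule measurable_compose_countable[OF _ assms])
  show "(\<lambda>x. case t of enat n \<Rightarrow> ereal (pay \<gamma> h y x n) | \<infinity> \<Rightarrow> - \<infinity>) \<in> borel_measurable S" for t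
    by (cases t) simp_all
qed

lemma stopped_eq_pay: "\<tau> x \<noteq> \<infinity> \<Longrightarrow> stopped \<tau> y x = ereal (pay \<gamma> h y x (the_enat (\<tau> x)))"
  by (auto simp: stopped_def)

lemma expectation_entry_B:
  "ereal_expectation S (stopped (entry B y) y) = ereal (\<integral>x. pay \<gamma> h y x (etime B y x) \<partial>S)"
  using AE_entry_finite[OF B_ray, of y]
  by (intro ereal_expectation_integrable integrable_pay_etime B_ray)
    (auto elim!: eventually_mono intro: stopped_eq_pay simp del: not_infinity_eq)

text \<open>The positive part has finite mean by \<open>sup_finite\<close>. If the negative part has
  infinite mean, the left side is \<open>- \<infinity>\<close>. Otherwise the value
  \<open>- \<infinity>\<close> assigned to never stopping forces \<open>\<tau>\<close> to be finite
  almost surely with integrable pay-off, and \<open>pay_stop_le\<close> applies.\<close>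

lemma expectation_stopped_le:
  assumes \<tau>: "stopping \<tau>"
  shows "ereal_expectation S (stopped \<tau> y) \<le> ereal_expectation S (stopped (entry B y) y)"
proof -
  have [measurable]: "\<tau> \<in> measurable S (count_space UNIV)"
    using \<tau> by (rule stopping_measurable)
  have [measurable]: "stopped \<tau> y \<in> borel_measurable S"
    by (rule measurable_stopped) measurable
  let ?p = "\<integral>\<^sup>+x. e2ennreal (stopped \<tau> y x) \<partial>S" and ?q = "\<integral>\<^sup>+x. e2ennreal (- stopped \<tau> y x) \<partial>S"
  have "?p \<le> (\<integral>\<^sup>+x. (SUP n. ennreal (pay \<gamma> h y x n)) \<partial>S)"
  proof (rule nn_integral_mono)
    show "e2ennreal (stopped \<tau> y x) \<le> (SUP n. ennreal (pay \<gamma> h y x n))" for x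
      by (cases "\<tau> x") (auto simp: stopped_def e2ennreal_neg intro: SUP_upper)
  qed
  then have p: "?p < \<infinity>"
    using sup_finite[of y] by (rule le_less_trans)
  show ?thesis
  proof (cases "?q = \<infinity>")
    case True
    have "ereal_expectation S (stopped \<tau> y) = - \<infinity>"
      unfolding ereal_expectation_def using True p by (cases ?p) auto
    then show ?thesis by simp
  next
    case False
    have "AE x in S. e2ennreal (- stopped \<tau> y x) \<noteq> \<infinity>"
      by (rule nn_integral_PInf_AE) (use False in simp_all)
    then have fin: "AE x in S. \<tau> x \<noteq> \<infinity>"
    proof eventually_elim
      case (elim x)
      show ?case
      proof
        assume "\<tau> x = \<infinity>"
        then show False using elim by (simp add: stopped_def)
      qed
    qed
    then have eq: "AE x in S. stopped \<tau> y x = ereal (pay \<gamma> h y x (the_enat (\<tau> x)))"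
      by eventually_elim (rule stopped_eq_pay)
    have I: "integrable S (\<lambda>x. pay \<gamma> h y x (the_enat (\<tau> x)))"
      unfolding real_integrable_def
    proof (intro conjI)
      have "(\<integral>\<^sup>+x. ennreal (pay \<gamma> h y x (the_enat (\<tau> x))) \<partial>S) = ?p"
        using eq by (intro nn_integral_cong_AE) (auto elim!: eventually_mono)
      then show "(\<integral>\<^sup>+x. ennreal (pay \<gamma> h y x (the_enat (\<tau> x))) \<partial>S) \<noteq> \<infinity>" using p by simp
      have "(\<integral>\<^sup>+x. ennreal (- pay \<gamma> h y x (the_enat (\<tau> x))) \<partial>S) = ?q"
        using eq by (intro nn_integral_cong_AE) (auto elim!: eventually_mono)
      then show "(\<integral>\<^sup>+x. ennreal (- pay \<gamma> h y x (the_enat (\<tau> x))) \<partial>S) \<noteq> \<infinity>" using False by simp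
    qed measurable
    show ?thesis
      unfolding ereal_expectation_integrable[OF I eq] expectation_entry_B
      using pay_stop_le[OF \<tau> fin I] by simp
  qed
qed

end

section \<open>The path of steps, its law and the natural filtration\<close>

definition step_path :: "(nat \<Rightarrow> 'a \<Rightarrow> real) \<Rightarrow> 'a \<Rightarrow> nat \<Rightarrow> real" where
  "step_path X \<omega> i = X (Suc i) \<omega>"

lemma walk_path: "walk X n \<omega> = psum (step_path X \<omega>) n"
  by (simp add: walk_def psum_def step_path_def sum.atLeast1_atMost_eq)

lemma running_cost_path: "running_cost h X y n \<omega> = cost h y (step_path X \<omega>) n"
  by (simp add: running_cost_def cost_def walk_path sum.atLeast1_atMost_eq)

lemma payoff_path: "payoff \<gamma> h X y n \<omega> = pay \<gamma> h y (step_path X \<omega>) n"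
  by (simp add: payoff_def pay_def running_cost_path walk_path)

lemma ladder_time_path: "ladder_time X \<omega> = ladder (step_path X \<omega>)"
  by (simp add: ladder_time_def ladder_def entry_from_def walk_path)

lemma ladder_reward_path: "ladder_reward \<gamma> X y \<omega> = \<gamma> (y + ladder_height (step_path X \<omega>))"
  by (simp add: ladder_reward_def ladder_time_path walk_path)

lemma ladder_cost_path: "ladder_cost h X y \<omega> = cost h y (step_path X \<omega>) (ltime (step_path X \<omega>))"
  by (simp add: ladder_cost_def ladder_time_path running_cost_path)

locale iid_walk = prob_space M for M :: "'a measure" +
  fixes X :: "nat \<Rightarrow> 'a \<Rightarrow> real"
  assumes iid: "iid_steps M X"
begin

definition law :: "real measure" where
  "law = distr M borel (X 1)"

lemma indep_steps: "indep_vars (\<lambda>_. borel) X {1..}"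
  using iid unfolding iid_steps_def by (rule conjunct1)

lemma distr_step: "i \<ge> 1 \<Longrightarrow> distr M borel (X i) = law"
  using iid unfolding iid_steps_def law_def by blast

lemma measurable_step: "i \<ge> 1 \<Longrightarrow> X i \<in> borel_measurable M"
  using indep_steps by (simp add: indep_vars_def)

lemma prob_space_law: "prob_space law"
  unfolding law_def by (rule prob_space_distr) (simp add: measurable_step)

sublocale steps: step_space law
proof -
  interpret L: prob_space law by (rule prob_space_law)
  show "step_space law"
    by unfold_locales (simp add: law_def)
qed

lemma measurable_path [measurable]: "step_path X \<in> measurable M steps.S"
proof -
  have "step_path X \<in> measurable M (\<Pi>\<^sub>M i\<in>UNIV::nat set. (borel :: real measure))"
  proof (rule measurable_PiM_single')
    show "(\<lambda>\<omega>. step_path X \<omega> i) \<in> borel_measurable M" for i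
      unfolding step_path_def by (simp add: measurable_step)
  qed (auto simp: space_PiM)
  then show ?thesis
    by (simp add: measurable_cong_sets[OF refl steps.sets_S_borel])
qed

text \<open>Independence makes the joint law of the steps a product; equal marginals and a shift of
  the index by one turn it into the infinite power of \<open>law\<close>.\<close>

lemma distr_path: "distr M steps.S (step_path X) = steps.S"
proof -
  define D where "D i = distr M borel (X i)" for i
  have D: "prob_space (D i)" if "i \<in> {1..}" for i
    unfolding D_def using that by (intro prob_space_distr) (simp add: measurable_step)
  have D_law: "D (Suc i) = law" for i
    by (simp add: D_def distr_step)
  let ?B = "\<Pi>\<^sub>M i\<in>{1::nat..}. (borel :: real measure)"
  let ?r = "\<lambda>\<omega>. \<lambda>i\<in>{1..}. X i \<omega>"
  have "distr M ?B ?r = (\<Pi>\<^sub>M i\<in>{1..}. D i)"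
    unfolding D_def using indep_steps measurable_step
    by (subst indep_vars_iff_distr_eq_PiM'[symmetric]) auto
  moreover have "distr (\<Pi>\<^sub>M i\<in>{1..}. D i) (\<Pi>\<^sub>M i\<in>UNIV. D (Suc i)) (\<lambda>\<omega>. \<lambda>n\<in>UNIV. \<omega> (Suc n)) = (\<Pi>\<^sub>M i\<in>UNIV. D (Suc i))"
    by (rule distr_PiM_reindex) (use D in auto)
  ultimately have "distr (distr M ?B ?r) steps.S (\<lambda>\<omega> n. \<omega> (Suc n)) = steps.S"
    by (simp add: D_law restrict_UNIV)
  moreover have "distr (distr M ?B ?r) steps.S (\<lambda>\<omega> n. \<omega> (Suc n)) = distr M steps.S ((\<lambda>\<omega> n. \<omega> (Suc n)) \<circ> ?r)"
  proof (rule distr_distr)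
    show "?r \<in> measurable M ?B"
      using measurable_step by (intro measurable_restrict) auto
    have "(\<lambda>\<omega> n. \<omega> (Suc n)) \<in> measurable ?B (\<Pi>\<^sub>M i\<in>UNIV::nat set. (borel :: real measure))"
      by (rule measurable_PiM_single') (auto simp: space_PiM)
    then show "(\<lambda>\<omega> n. \<omega> (Suc n)) \<in> measurable ?B steps.S"
      by (simp add: measurable_cong_sets[OF refl steps.sets_S_borel])
  qed
  moreover have "(\<lambda>\<omega> n. \<omega> (Suc n)) \<circ> ?r = step_path X"
    by (auto simp: step_path_def fun_eq_iff)
  ultimately show ?thesis by simp
qed

lemma nn_integral_path:
  "f \<in> borel_measurable steps.S \<Longrightarrow> (\<integral>\<^sup>+\<omega>. f (step_path X \<omega>) \<partial>M) = (\<integral>\<^sup>+x. f x \<partial>steps.S)"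
  using nn_integral_distr[of "step_path X" M steps.S f] by (simp add: distr_path)

lemma integrable_path:
  fixes f :: "(nat \<Rightarrow> real) \<Rightarrow> real"
  shows "f \<in> borel_measurable steps.S \<Longrightarrow> integrable M (\<lambda>\<omega>. f (step_path X \<omega>)) \<longleftrightarrow> integrable steps.S f"
  using integrable_distr_eq[of "step_path X" M steps.S f] by (simp add: distr_path)

lemma integral_path:
  fixes f :: "(nat \<Rightarrow> real) \<Rightarrow> real"
  shows "f \<in> borel_measurable steps.S \<Longrightarrow> (\<integral>\<omega>. f (step_path X \<omega>) \<partial>M) = (\<integral>x. f x \<partial>steps.S)"
  using integral_distr[of "step_path X" M steps.S f] by (simp add: distr_path)

lemma ereal_expectation_path:
  assumes [measurable]: "Z \<in> borel_measurable steps.S"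
  shows "ereal_expectation M (\<lambda>\<omega>. Z (step_path X \<omega>)) = ereal_expectation steps.S Z"
  unfolding ereal_expectation_def
  using nn_integral_path[of "\<lambda>x. e2ennreal (Z x)"] nn_integral_path[of "\<lambda>x. e2ennreal (- Z x)"] by simp

lemma sets_walk_filtration:
  "sets (walk_filtration M X t) = sigma_sets (space M)
    {walk X i -` C \<inter> space M | i C. enat i \<le> t \<and> C \<in> sets (borel :: real measure)}"
  unfolding walk_filtration_def by (rule sets_measure_of) auto

lemma space_walk_filtration: "space (walk_filtration M X t) = space M"
  unfolding walk_filtration_def by (rule space_measure_of) auto

text \<open>By induction over the generated sigma-algebra. \<open>D\<close> has to depend on the
  first \<open>n\<close> coordinates on the whole path space, not just on realised paths, because
  \<open>stopping\<close> quantifies over all paths.\<close>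

lemma walk_filtration_path:
  assumes "A \<in> sets (walk_filtration M X (enat n))"
  obtains D where "D \<in> sets steps.S" "\<And>x y. (\<And>i. i < n \<Longrightarrow> x i = y i) \<Longrightarrow> x \<in> D \<longleftrightarrow> y \<in> D"
    "A = {\<omega> \<in> space M. step_path X \<omega> \<in> D}"
proof -
  have "\<exists>D\<in>sets steps.S. (\<forall>x y. (\<forall>i<n. x i = y i) \<longrightarrow> x \<in> D \<longleftrightarrow> y \<in> D) \<and> A = {\<omega> \<in> space M. step_path X \<omega> \<in> D}"
    using assms unfolding sets_walk_filtration
  proof (induction rule: sigma_sets.induct)
    case (Basic A)
    then obtain i C where iC: "A = walk X i -` C \<inter> space M" "i \<le> n" "C \<in> sets borel" by auto
    have [measurable]: "C \<in> sets borel" by fact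
    show ?case
    proof (intro bexI[of _ "{x \<in> space steps.S. psum x i \<in> C}"] conjI allI impI)
      fix x y :: "nat \<Rightarrow> real" assume "\<forall>i<n. x i = y i"
      then have "psum x i = psum y i" using iC(2) by (intro psum_cong) auto
      then show "x \<in> {x \<in> space steps.S. psum x i \<in> C} \<longleftrightarrow> y \<in> {x \<in> space steps.S. psum x i \<in> C}" by simp
    next
      show "A = {\<omega> \<in> space M. step_path X \<omega> \<in> {x \<in> space steps.S. psum x i \<in> C}}"
        using iC(1) by (auto simp: walk_path)
    qed measurable
  next
    case Empty
    show ?case by (intro bexI[of _ "{}"]) auto
  next
    case (Compl A)
    then obtain D where "D \<in> sets steps.S" "\<forall>x y. (\<forall>i<n. x i = y i) \<longrightarrow> x \<in> D \<longleftrightarrow> y \<in> D"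
      "A = {\<omega> \<in> space M. step_path X \<omega> \<in> D}" by blast
    moreover from this(1) have "space steps.S - D \<in> sets steps.S"
      by (rule sets.compl_sets)
    ultimately show ?case by (intro bexI[of _ "space steps.S - D"]) auto
  next
    case (Union A)
    have "\<exists>D. D \<in> sets steps.S \<and> (\<forall>x y. (\<forall>i<n. x i = y i) \<longrightarrow> x \<in> D \<longleftrightarrow> y \<in> D) \<and>
        A k = {\<omega> \<in> space M. step_path X \<omega> \<in> D}" for k
      using Union.IH[of k] unfolding Bex_def .
    then obtain D where DD: "\<forall>k. D k \<in> sets steps.S \<and> (\<forall>x y. (\<forall>i<n. x i = y i) \<longrightarrow> x \<in> D k \<longleftrightarrow> y \<in> D k) \<and>
        A k = {\<omega> \<in> space M. step_path X \<omega> \<in> D k}"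
      using choice[of "\<lambda>k D. D \<in> sets steps.S \<and> (\<forall>x y. (\<forall>i<n. x i = y i) \<longrightarrow> x \<in> D \<longleftrightarrow> y \<in> D) \<and>
        A k = {\<omega> \<in> space M. step_path X \<omega> \<in> D}"] by blast
    have D1: "D k \<in> sets steps.S" for k
      using DD[THEN spec, of k] by (rule conjunct1)
    have D2: "\<forall>x y. (\<forall>i<n. x i = y i) \<longrightarrow> x \<in> D k \<longleftrightarrow> y \<in> D k" for k
      using DD[THEN spec, of k] by (elim conjE)
    have D3: "A k = {\<omega> \<in> space M. step_path X \<omega> \<in> D k}" for k
      using DD[THEN spec, of k] by (elim conjE)
    show ?case
    proof (intro bexI[of _ "\<Union>k. D k"] conjI allI impI)
      fix x y :: "nat \<Rightarrow> real" assume xy: "\<forall>i<n. x i = y i"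
      have "x \<in> D k \<longleftrightarrow> y \<in> D k" for k
        using D2[THEN spec, THEN spec, THEN mp, OF xy] .
      then show "x \<in> (\<Union>k. D k) \<longleftrightarrow> y \<in> (\<Union>k. D k)" by blast
    next
      show "(\<Union>k. A k) = {\<omega> \<in> space M. step_path X \<omega> \<in> (\<Union>k. D k)}"
        unfolding D3 by blast
    qed (use D1 in blast)
  qed
  then obtain D where D: "D \<in> sets steps.S" "\<forall>x y. (\<forall>i<n. x i = y i) \<longrightarrow> x \<in> D \<longleftrightarrow> y \<in> D"
    "A = {\<omega> \<in> space M. step_path X \<omega> \<in> D}" by blast
  show thesis
  proof (rule that[OF D(1) _ D(3)])
    fix x y :: "nat \<Rightarrow> real" assume "\<And>i. i < n \<Longrightarrow> x i = y i"
    then have "\<forall>i<n. x i = y i" by simp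
    then show "x \<in> D \<longleftrightarrow> y \<in> D" by (rule D(2)[THEN spec, THEN spec, THEN mp])
  qed
qed

text \<open>Each event \<open>\<tau> \<le> n\<close> is the preimage of a path set
  \<open>D n\<close>. Off the realised paths these sets need not increase in \<open>n\<close>;
  taking the first \<open>n\<close> with the path in \<open>D n\<close> gives a stopping time on all
  paths regardless.\<close>

lemma stopping_time_path:
  assumes \<tau>: "stopping_time (walk_filtration M X) \<tau>"
  obtains \<tau>' where "steps.stopping \<tau>'" "\<And>\<omega>. \<omega> \<in> space M \<Longrightarrow> \<tau> \<omega> = \<tau>' (step_path X \<omega>)"
proof -
  have "\<exists>D. D \<in> sets steps.S \<and> (\<forall>x y. (\<forall>i<n. x i = y i) \<longrightarrow> x \<in> D \<longleftrightarrow> y \<in> D) \<and>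
      {\<omega> \<in> space M. \<tau> \<omega> \<le> enat n} = {\<omega> \<in> space M. step_path X \<omega> \<in> D}" for n
  proof -
    have "{\<omega> \<in> space M. \<tau> \<omega> \<le> enat n} \<in> sets (walk_filtration M X (enat n))"
      using stopping_timeD[OF \<tau>, of "enat n"] by (simp add: Measurable.pred_def space_walk_filtration)
    then show ?thesis by (rule walk_filtration_path) blast
  qed
  then obtain D where DD: "\<forall>n. D n \<in> sets steps.S \<and> (\<forall>x y. (\<forall>i<n. x i = y i) \<longrightarrow> x \<in> D n \<longleftrightarrow> y \<in> D n) \<and>
      {\<omega> \<in> space M. \<tau> \<omega> \<le> enat n} = {\<omega> \<in> space M. step_path X \<omega> \<in> D n}"
    using choice[of "\<lambda>n D. D \<in> sets steps.S \<and> (\<forall>x y. (\<forall>i<n. x i = y i) \<longrightarrow> x \<in> D \<longleftrightarrow> y \<in> D) \<and>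
      {\<omega> \<in> space M. \<tau> \<omega> \<le> enat n} = {\<omega> \<in> space M. step_path X \<omega> \<in> D}"] by blast
  have D1: "D n \<in> sets steps.S" for n
    using DD[THEN spec, of n] by (rule conjunct1)
  have D2: "\<forall>x y. (\<forall>i<n. x i = y i) \<longrightarrow> x \<in> D n \<longleftrightarrow> y \<in> D n" for n
    using DD[THEN spec, of n] by (elim conjE)
  have D3: "{\<omega> \<in> space M. \<tau> \<omega> \<le> enat n} = {\<omega> \<in> space M. step_path X \<omega> \<in> D n}" for n
    using DD[THEN spec, of n] by (elim conjE)
  define \<tau>' where "\<tau>' x = first_time (\<lambda>n. x \<in> D n)" for x
  have "steps.stopping \<tau>'"
    unfolding steps.stopping_def
  proof (intro conjI allI impI)
    show "\<tau>' \<in> measurable steps.S (count_space UNIV)"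
      unfolding \<tau>'_def[abs_def] using D1 by (intro measurable_first_time) simp
    fix n x y assume x: "\<tau>' x = enat n" and xy: "\<forall>i<n. x i = (y i :: real)"
    have "x \<in> D m \<longleftrightarrow> y \<in> D m" if "m \<le> n" for m
    proof -
      have "\<forall>i<m. x i = y i" using xy that by simp
      then show ?thesis by (rule D2[THEN spec, THEN spec, THEN mp])
    qed
    then show "\<tau>' y = enat n"
      using x unfolding \<tau>'_def by (rule first_time_cong_upto[rotated])
  qed
  moreover have "\<tau> \<omega> = \<tau>' (step_path X \<omega>)" if "\<omega> \<in> space M" for \<omega>
  proof -
    have iff: "step_path X \<omega> \<in> D n \<longleftrightarrow> \<tau> \<omega> \<le> enat n" for n
      using D3[of n] that by blast
    show ?thesis
    proof (cases "\<tau> \<omega>")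
      case (enat k)
      then have "\<tau>' (step_path X \<omega>) = enat k"
        by (simp add: \<tau>'_def first_time_eq_enat iff)
      then show ?thesis using enat by simp
    next
      case infinity
      then have "\<tau>' (step_path X \<omega>) = \<infinity>"
        by (simp add: \<tau>'_def first_time_eq_infinity iff)
      then show ?thesis using infinity by simp
    qed
  qed
  ultimately show thesis by (rule that)
qed

lemma stopping_time_entry:
  assumes U: "U \<in> sets borel"
  shows "stopping_time (walk_filtration M X) (\<lambda>\<omega>. first_time (\<lambda>n. y + walk X n \<omega> \<in> U))"
proof (rule stopping_timeI)
  fix t
  show "Measurable.pred (walk_filtration M X t) (\<lambda>\<omega>. first_time (\<lambda>n. y + walk X n \<omega> \<in> U) \<le> t)"
  proof (cases t)
    case (enat k)
    have "Measurable.pred (walk_filtration M X t) (\<lambda>\<omega>. y + walk X m \<omega> \<in> U)" if "m \<le> k" for m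
    proof -
      have *: "(\<lambda>s. y + s) -` U \<in> sets borel"
        using measurable_sets[of "\<lambda>s. y + s" borel borel U] U by simp
      have "walk X m -` ((\<lambda>s. y + s) -` U) \<inter> space M \<in> sets (walk_filtration M X t)"
        unfolding sets_walk_filtration using * that enat by (intro sigma_sets.Basic) auto
      moreover have "walk X m -` ((\<lambda>s. y + s) -` U) \<inter> space M = {\<omega> \<in> space (walk_filtration M X t). y + walk X m \<omega> \<in> U}"
        by (auto simp: space_walk_filtration)
      ultimately show ?thesis by (simp add: Measurable.pred_def)
    qed
    then have "Measurable.pred (walk_filtration M X t) (\<lambda>\<omega>. \<exists>m\<in>{..k}. y + walk X m \<omega> \<in> U)"
      by (intro pred_intros_finite) auto
    moreover have "first_time (\<lambda>n. y + walk X n \<omega> \<in> U) \<le> t \<longleftrightarrow> (\<exists>m\<in>{..k}. y + walk X m \<omega> \<in> U)" for \<omega>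
      unfolding enat first_time_le_iff by blast
    ultimately show ?thesis
      by (simp only:)
  qed simp
qed

lemma optimal_rule_entry:
  assumes "threshold_problem law \<gamma> h xbar B"
  shows "optimal_rule M X \<gamma> h (\<lambda>y \<omega>. first_time (\<lambda>n. y + walk X n \<omega> \<in> B))"
  unfolding optimal_rule_def
proof (intro allI conjI)
  fix y
  interpret T: threshold_problem law \<gamma> h xbar B by fact
  let ?\<tau> = "\<lambda>\<omega>. first_time (\<lambda>n. y + walk X n \<omega> \<in> B)"
  show st: "stopping_time (walk_filtration M X) ?\<tau>"
    by (rule stopping_time_entry[OF T.B_sets])
  \<comment> \<open>Applied both to the threshold rule and to every competing stopping time.\<close>
  have ex: "ereal_expectation M (stopped_payoff \<gamma> h X y \<sigma>) = ereal_expectation steps.S (T.stopped \<sigma>' y)"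
    if stop: "steps.stopping \<sigma>'" and eq: "\<And>\<omega>. \<omega> \<in> space M \<Longrightarrow> \<sigma> \<omega> = \<sigma>' (step_path X \<omega>)" for \<sigma> \<sigma>'
  proof -
    have "ereal_expectation M (stopped_payoff \<gamma> h X y \<sigma>) = ereal_expectation M (\<lambda>\<omega>. T.stopped \<sigma>' y (step_path X \<omega>))"
    proof -
      have "stopped_payoff \<gamma> h X y \<sigma> \<omega> = T.stopped \<sigma>' y (step_path X \<omega>)" if "\<omega> \<in> space M" for \<omega>
        unfolding stopped_payoff_def T.stopped_def payoff_path by (simp only: eq[OF that])
      then show ?thesis
        unfolding ereal_expectation_def by (simp cong: nn_integral_cong_simp)
    qed
    also have "\<dots> = ereal_expectation steps.S (T.stopped \<sigma>' y)"
      by (intro ereal_expectation_path T.measurable_stopped steps.stopping_measurable stop)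
    finally show ?thesis .
  qed
  have opt: "ereal_expectation M (stopped_payoff \<gamma> h X y ?\<tau>) = ereal_expectation steps.S (T.stopped (entry B y) y)"
    by (rule ex[OF steps.stopping_entry_from[OF T.B_sets]]) (simp add: entry_from_def walk_path)
  show "ereal_expectation M (stopped_payoff \<gamma> h X y ?\<tau>) = stopping_value M X \<gamma> h y"
    unfolding stopping_value_def
  proof (rule antisym)
    show "ereal_expectation M (stopped_payoff \<gamma> h X y ?\<tau>)
      \<le> (SUP \<tau>\<in>{\<tau>. stopping_time (walk_filtration M X) \<tau>}. ereal_expectation M (stopped_payoff \<gamma> h X y \<tau>))"
      using st by (intro SUP_upper) simp
    show "(SUP \<tau>\<in>{\<tau>. stopping_time (walk_filtration M X) \<tau>}. ereal_expectation M (stopped_payoff \<gamma> h X y \<tau>))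
      \<le> ereal_expectation M (stopped_payoff \<gamma> h X y ?\<tau>)"
    proof (rule SUP_least)
      fix \<sigma> assume "\<sigma> \<in> {\<tau>. stopping_time (walk_filtration M X) \<tau>}"
      then have "stopping_time (walk_filtration M X) \<sigma>" by simp
      then obtain \<sigma>' where s: "steps.stopping \<sigma>'" "\<And>\<omega>. \<omega> \<in> space M \<Longrightarrow> \<sigma> \<omega> = \<sigma>' (step_path X \<omega>)"
        by (rule stopping_time_path) blast
      show "ereal_expectation M (stopped_payoff \<gamma> h X y \<sigma>) \<le> ereal_expectation M (stopped_payoff \<gamma> h X y ?\<tau>)"
        using T.expectation_stopped_le[OF s(1)] ex[OF s] opt by simp
    qed
  qed
qed

lemma walk_problem_law:
  assumes "mono \<gamma>" "mono h" "\<And>u. h u \<ge> 0"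
    and wd: "ladder_f_well_defined M X \<gamma> h"
    and sup: "\<And>y. ereal_expectation M (\<lambda>\<omega>. SUP n. ereal (payoff \<gamma> h X y n \<omega>)) < \<infinity>"
  shows "walk_problem law \<gamma> h"
proof
  have [measurable]: "\<gamma> \<in> borel_measurable borel" "h \<in> borel_measurable borel"
    using assms by (auto intro: borel_measurable_mono)
  show "mono \<gamma>" "mono h" "h u \<ge> 0" for u by fact+
  have "mean_ladder_time M X = (\<integral>\<^sup>+x. ennreal_of_enat (ladder x) \<partial>steps.S)"
    unfolding mean_ladder_time_def ladder_time_path by (rule nn_integral_path) measurable
  then show "(\<integral>\<^sup>+x. ennreal_of_enat (ladder x) \<partial>steps.S) < \<infinity>"
    using wd by (simp add: ladder_f_well_defined_def)
  fix y
  have "integrable M (\<lambda>\<omega>. \<gamma> (y + ladder_height (step_path X \<omega>)))"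
    using wd by (simp add: ladder_f_well_defined_def flip: ladder_reward_path)
  then show "integrable steps.S (\<lambda>x. \<gamma> (y + ladder_height x))"
    by (subst (asm) integrable_path) measurable
  have "integrable M (\<lambda>\<omega>. cost h y (step_path X \<omega>) (ltime (step_path X \<omega>)))"
    using wd by (simp add: ladder_f_well_defined_def flip: ladder_cost_path)
  then show "integrable steps.S (\<lambda>x. cost h y x (ltime x))"
    by (subst (asm) integrable_path) measurable
  \<comment> \<open>In \<open>ereal\<close> an infinite positive part yields
    \<open>\<infinity>\<close> whatever is subtracted, so the assumption makes the mean of the
    positive part finite.\<close>
  have fin: "(\<integral>\<^sup>+\<omega>. e2ennreal (SUP n. ereal (payoff \<gamma> h X y n \<omega>)) \<partial>M) < \<infinity>"
    using sup[of y] unfolding ereal_expectation_def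
    by (cases "\<integral>\<^sup>+\<omega>. e2ennreal (SUP n. ereal (payoff \<gamma> h X y n \<omega>)) \<partial>M") auto
  have "(\<integral>\<^sup>+x. (SUP n. ennreal (pay \<gamma> h y x n)) \<partial>steps.S) = (\<integral>\<^sup>+\<omega>. (SUP n. ennreal (pay \<gamma> h y (step_path X \<omega>) n)) \<partial>M)"
    by (rule nn_integral_path[symmetric]) measurable
  also have "\<dots> \<le> (\<integral>\<^sup>+\<omega>. e2ennreal (SUP n. ereal (payoff \<gamma> h X y n \<omega>)) \<partial>M)"
  proof (rule nn_integral_mono, rule SUP_least)
    fix \<omega> n
    have "ennreal (pay \<gamma> h y (step_path X \<omega>) n) = e2ennreal (ereal (payoff \<gamma> h X y n \<omega>))"
      by (simp add: payoff_path)
    also have "\<dots> \<le> e2ennreal (SUP n. ereal (payoff \<gamma> h X y n \<omega>))"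
      by (intro e2ennreal_mono SUP_upper) simp
    finally show "ennreal (pay \<gamma> h y (step_path X \<omega>) n) \<le> e2ennreal (SUP n. ereal (payoff \<gamma> h X y n \<omega>))" .
  qed
  finally show "(\<integral>\<^sup>+x. (SUP n. ennreal (pay \<gamma> h y x n)) \<partial>steps.S) < \<infinity>"
    using fin by (rule le_less_trans)
qed

end

theorem theorem2p9:
  fixes M :: "'a measure" and X :: "nat \<Rightarrow> 'a \<Rightarrow> real"
    and \<gamma> h :: "real \<Rightarrow> real" and xbar :: real
  assumes "prob_space M"
    and "iid_steps M X"
    and "measure M {\<omega> \<in> space M. X 1 \<omega> > 0} > 0"
    and "mono \<gamma>"
    and "ladder_f_well_defined M X \<gamma> h"
    and "ereal xbar = Inf (ereal ` threshold_set M X \<gamma> h)"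
    and "\<And>y. ereal_expectation M (\<lambda>\<omega>. SUP n. ereal (payoff \<gamma> h X y n \<omega>)) < \<infinity>"
    and "\<And>y. AE \<omega> in M. filterlim (\<lambda>n. payoff \<gamma> h X y n \<omega>) at_bot sequentially"
    and "concave_on {xbar..} \<gamma>"
    and "mono h" and "\<And>x. h x \<ge> 0"
  shows "(ladder_f M X \<gamma> h xbar \<le> 0 \<longrightarrow>
            optimal_rule M X \<gamma> h (\<lambda>y \<omega>. first_time (\<lambda>n. y + walk X n \<omega> \<ge> xbar))) \<and>
         (ladder_f M X \<gamma> h xbar > 0 \<longrightarrow>
            optimal_rule M X \<gamma> h (\<lambda>y \<omega>. first_time (\<lambda>n. y + walk X n \<omega> > xbar)))"
proof -
  interpret prob_space M by fact
  interpret iid_walk M X by unfold_locales fact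
  interpret W: walk_problem law \<gamma> h
    by (rule walk_problem_law[OF assms(4,10,11,5,7)])
  have phi: "ladder_phi M X \<gamma> h y = W.phi y" for y
    unfolding ladder_phi_def W.phi_def pay_def ladder_reward_path ladder_cost_path
    by (rule integral_path[where f = "\<lambda>x. \<gamma> (y + ladder_height x) - cost h y x (ltime x)"]) measurable
  have mean: "enn2real (mean_ladder_time M X) = W.mean_ltime"
  proof -
    have "mean_ladder_time M X = (\<integral>\<^sup>+x. ennreal_of_enat (ladder x) \<partial>steps.S)"
      unfolding mean_ladder_time_def ladder_time_path by (rule nn_integral_path) measurable
    also have "\<dots> = (\<integral>\<^sup>+x. ennreal (real (ltime x)) \<partial>steps.S)"
      using W.AE_ladder_finite
      by (intro nn_integral_cong_AE) (auto elim!: eventually_mono simp: ennreal_of_nat_eq_real_of_nat)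
    also have "\<dots> = ennreal W.mean_ltime"
      unfolding W.mean_ltime_def by (rule nn_integral_eq_integral[OF W.integrable_ltime]) simp
    finally show ?thesis using W.mean_ltime_ge_1 by simp
  qed
  have f_pos: "ladder_f M X \<gamma> h y > 0 \<longleftrightarrow> \<gamma> y < W.phi y" for y
    using W.mean_ltime_ge_1 by (simp add: ladder_f_def phi mean zero_less_divide_iff)
  \<comment> \<open>The defining inequality rearranges to \<open>phi y \<le> \<gamma> y\<close>,
    that is \<open>f y \<le> 0\<close>; well-definedness of \<open>f\<close> permits splitting the
    integrals.\<close>
  have thr: "y \<in> threshold_set M X \<gamma> h \<longleftrightarrow> W.phi y \<le> \<gamma> y" for y
  proof -
    have "(\<integral>\<omega>. \<gamma> y - ladder_reward \<gamma> X y \<omega> \<partial>M) = \<gamma> y - (\<integral>\<omega>. ladder_reward \<gamma> X y \<omega> \<partial>M)"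
      "W.phi y = (\<integral>\<omega>. ladder_reward \<gamma> X y \<omega> \<partial>M) - (\<integral>\<omega>. ladder_cost h X y \<omega> \<partial>M)"
      using assms(5) prob_space by (simp_all add: ladder_f_well_defined_def ladder_phi_def flip: phi)
    then show ?thesis by (auto simp: threshold_set_def)
  qed
  have below_xbar: "\<gamma> y < W.phi y" if "y < xbar" for y
  proof (rule ccontr)
    assume "\<not> \<gamma> y < W.phi y"
    then have "ereal xbar \<le> ereal y"
      unfolding assms(6) by (intro Inf_lower) (simp add: thr)
    then show False using that by simp
  qed
  have antimono: "W.phi y - \<gamma> y \<le> W.phi z - \<gamma> z" if "xbar \<le> z" "z \<le> y" for y z
    using W.phi_diff_antimono_of_concave[OF assms(9) that] .
  show ?thesis
  proof (intro conjI impI)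
    assume "ladder_f M X \<gamma> h xbar \<le> 0"
    then have le: "W.phi xbar \<le> \<gamma> xbar" using f_pos[of xbar] by linarith
    have "threshold_problem law \<gamma> h xbar {xbar..}"
    proof
      show "W.phi z \<le> \<gamma> z" if "z \<in> {xbar..}" for z
        using antimono[of xbar z] le that by simp
      show "\<gamma> z \<le> W.phi z" if "z \<notin> {xbar..}" for z
        using below_xbar[of z] that by simp
    qed (use assms(9) in auto)
    from optimal_rule_entry[OF this]
    show "optimal_rule M X \<gamma> h (\<lambda>y \<omega>. first_time (\<lambda>n. y + walk X n \<omega> \<ge> xbar))"
      by simp
  next
    assume "ladder_f M X \<gamma> h xbar > 0"
    then have gt: "\<gamma> xbar < W.phi xbar" using f_pos by simp
    have "threshold_problem law \<gamma> h xbar {xbar<..}"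
    proof
      show "W.phi z \<le> \<gamma> z" if "z \<in> {xbar<..}" for z
      proof -
        \<comment> \<open>As \<open>xbar\<close> is the infimum, some \<open>d\<close> in the
          threshold set lies below \<open>z\<close>; there \<open>phi d \<le> \<gamma> d\<close>,
          and antimonotonicity carries this up to \<open>z\<close>.\<close>
        have "Inf (ereal ` threshold_set M X \<gamma> h) < ereal z"
          using that by (simp flip: assms(6))
        then obtain d where d: "d \<in> threshold_set M X \<gamma> h" "d < z"
          by (auto simp: Inf_less_iff)
        then have "xbar \<le> d" using below_xbar[of d] thr[of d] by linarith
        then show ?thesis using antimono[of d z] d thr[of d] by simp
      qed
      show "\<gamma> z \<le> W.phi z" if "z \<notin> {xbar<..}" for z
        using below_xbar[of z] gt that by (cases "z = xbar") auto
    qed (use assms(9) in auto)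
    from optimal_rule_entry[OF this]
    show "optimal_rule M X \<gamma> h (\<lambda>y \<omega>. first_time (\<lambda>n. y + walk X n \<omega> > xbar))"
      by simp
  qed
qed

end
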